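(* Let $u$ be the solution of the parabolic problem $\partial_t u+\mathcal{L}u=f$ in $\Omega\times(0,T]$, $u(\cdot,0)=u^0$, $u=0$ on $\partial\Omega\times[0,T]$, and let the Green's function bounds (with constants $\kappa_0,\kappa_1,\kappa_1',\gamma$) stated in the context hold. Let $0=t_0<t_1<\dots<t_M=T$ be an arbitrary mesh and let $U^j\in H_0^1(\Omega)$ be the Crank-Nicolson approximations: $U^0=u^0$ and $$\frac{U^j-U^{j-1}}{\tau_j}+\frac{\mathcal{L}U^j+\mathcal{L}U^{j-1}}{2}=\frac{f^j+f^{j-1}}{2}\quad\text{in }\Omega,\qquad j=1,\dots,M.$$ Then $$\|u(T)-U^M\|_{\infty,\Omega}\le\sum_{j=1}^M\mathrm{e}^{-\gamma(T-t_j)}\left(\eta_{\hat f}^j+\eta_{\delta\psi}^j\right)$$ with $$\eta_{\hat f}^j:=\kappa_0\int_{I_j}\|(f-\hat f)(s)\|_{\infty,\Omega}\,\mathrm{d}s,\qquad \eta_{\delta\psi}^j:=\frac{\Psi_{1,j}}{2}\|\delta_t\psi^j\|_{\infty,\Omega},\qquad \psi^j:=\mathcal{L}U^j-f^j,$$ where $\Psi_{1,j}:=\min\{\Phi_{1,j},\Phi_{1,j}^*\}$ and $$\Phi_{1,j}:=\kappa_1\int_{t_{j-1}}^{t_j}\frac{(t_j-s)(s-t_{j-1})}{T-s}\,\mathrm{d}s+\kappa_1'\frac{\tau_j^3}{6},\qquad \Phi_{1,j}^*:=\kappa_0\int_{t_{j-1}}^{t_j}\left|\frac{\mathrm{d}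}{\mathrm{d}s}\left[(t_j-s)(s-t_{j-1})\right]\right|\mathrm{d}s.$$
   Context: Setting. $\Omega\subset\mathbb{R}^n$ is a spatial domain with Lipschitz boundary, $T>0$, $\mathcal{L}$ is a second-order linear elliptic operator in $\Omega$ with adjoint $\mathcal{L}^*$, $f\colon[0,T]\to L_2(\Omega)$, and $\mathcal{K}w:=\partial_t w+\mathcal{L}w$. For functions $w$ on $\Omega\times[0,T]$ write $w(t):=w(\cdot,t)$. $\|\cdot\|_{p,\Omega}$, $p\in[1,\infty]$, is the norm of $L_p(\Omega)$, and $\langle\cdot,\cdot\rangle$ denotes both the duality pairing on $H^{-1}(\Omega)\times H_0^1(\Omega)$ and the $L_2(\Omega)$ scalar product. Green's function. For fixed $x\in\Omega$, $\mathcal{G}$ solves $\partial_t\mathcal{G}+\mathcal{L}^*\mathcal{G}=0$ in $\Omega\times\mathbb{R}^+$, $\mathcal{G}|_{\partial\Omega}=0$, $\mathcal{G}(0)=\delta_x$ (Dirac distribution at $x$). For all $w\in W^{1,1}([0,T],H_0^1(\Omega))$ and $t\in(0,T]$ one has $w(x,t)=\langle\mathcal{G}(t),w(0)\rangle+\int_0^t\langle\mathcal{G}(t-s),(\mathcal{K}w)(s)\rangle\,\mathrm{d}s$; the solution $u$ is assumed regular enough that this representation applies to $u$ minus a continuous function that is piecewise polynomial in time and built from the discrete approximations. Standing assumption. There are non-negative constants $\kappa_0,\kappa_1,\kappa_2,\kappa_1',\kappa_2',\gamma$ such that, with $\kappa_0'=0$, $\|\partial_t^p\mathcal{G}(t)\|_{1,\Omega}\le\left(\frac{\kappa_p}{t^p}+\kappa_p'\right)\mathrm{e}^{-\gamma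 t}$ for all $x\in\bar\Omega$, $t\in[0,T]$, $p=0,1,2$. Mesh notation. $I_j:=(t_{j-1},t_j)$, $\tau_j:=t_j-t_{j-1}$; $f^j:=f(t_j)$; $\delta_t v^j:=(v^j-v^{j-1})/\tau_j$. $\hat f$ is the piecewise linear interpolant in time of $f$ on the mesh: $\hat f(s)=f^j-(t_j-s)\,\delta_tf^j$ for $s\in[t_{j-1},t_j]$. *)

theory Defs
  imports "HOL-Probability.Essential_Supremum"
begin

section \<open>Domains and function spaces\<close>

text \<open>
  Functions on \<open>\<Omega>\<close> are total functions whose values outside \<open>\<Omega>\<close> are irrelevant; elements of
  Lebesgue and Sobolev spaces are represented by functions, not by classes modulo null sets.
\<close>

definition lipschitz_domain :: "(real^'n) set \<Rightarrow> bool" where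
  "lipschitz_domain \<Omega> \<longleftrightarrow> open \<Omega> \<and> connected \<Omega> \<and> \<Omega> \<noteq> {} \<and>
     (\<forall>z\<in>frontier \<Omega>. \<exists>e g C r. norm e = 1 \<and> r > 0 \<and> C-lipschitz_on {y. y \<bullet> e = 0} g \<and>
        (\<forall>x\<in>ball z r. x \<in> \<Omega> \<longleftrightarrow> g (x - (x \<bullet> e) *\<^sub>R e) < x \<bullet> e))"

definition L2 :: "(real^'n) set \<Rightarrow> (real^'n \<Rightarrow> 'b::euclidean_space) set" where
  "L2 \<Omega> = {w. w \<in> borel_measurable (lebesgue_on \<Omega>) \<and>
              integrable (lebesgue_on \<Omega>) (\<lambda>x. (norm (w x))\<^sup>2)}"

definition L2_norm :: "(real^'n) set \<Rightarrow> (real^'n \<Rightarrow> 'b::euclidean_space) \<Rightarrow> real" where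
  "L2_norm \<Omega> w = sqrt (LINT x|lebesgue_on \<Omega>. (norm (w x))\<^sup>2)"

definition L2_inner :: "(real^'n) set \<Rightarrow> (real^'n \<Rightarrow> real) \<Rightarrow> (real^'n \<Rightarrow> real) \<Rightarrow> real" where
  "L2_inner \<Omega> v w = (LINT x|lebesgue_on \<Omega>. v x * w x)"

definition L1_norm :: "(real^'n) set \<Rightarrow> (real^'n \<Rightarrow> real) \<Rightarrow> ennreal" where
  "L1_norm \<Omega> w = (\<integral>\<^sup>+x. ennreal \<bar>w x\<bar> \<partial>lebesgue_on \<Omega>)"

definition Linf_norm :: "(real^'n) set \<Rightarrow> (real^'n \<Rightarrow> real) \<Rightarrow> ennreal" where
  "Linf_norm \<Omega> w = esssup (lebesgue_on \<Omega>) (\<lambda>x. ennreal \<bar>w x\<bar>)"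

text \<open>
  Test functions are taken from \<open>C\<^sub>c\<^sup>1(\<Omega>)\<close>, as in Gilbarg and Trudinger's treatment of first-order
  Sobolev spaces; \<open>D\<close> is the gradient of \<open>\<phi>\<close>.
\<close>

definition test_fun :: "(real^'n) set \<Rightarrow> (real^'n \<Rightarrow> real) \<Rightarrow> (real^'n \<Rightarrow> real^'n) \<Rightarrow> bool" where
  "test_fun \<Omega> \<phi> D \<longleftrightarrow> (\<forall>x. (\<phi> has_derivative (\<lambda>h. D x \<bullet> h)) (at x)) \<and> continuous_on UNIV D \<and>
     compact (closure {x. \<phi> x \<noteq> 0}) \<and> closure {x. \<phi> x \<noteq> 0} \<subseteq> \<Omega>"

definition has_weak_gradient ::
    "(real^'n) set \<Rightarrow> (real^'n \<Rightarrow> real) \<Rightarrow> (real^'n \<Rightarrow> real^'n) \<Rightarrow> bool" where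
  "has_weak_gradient \<Omega> w g \<longleftrightarrow> (\<forall>\<phi> D. test_fun \<Omega> \<phi> D \<longrightarrow>
     (LINT x|lebesgue_on \<Omega>. w x *\<^sub>R D x) = - (LINT x|lebesgue_on \<Omega>. \<phi> x *\<^sub>R g x))"

definition H1 :: "(real^'n) set \<Rightarrow> (real^'n \<Rightarrow> real) set" where
  "H1 \<Omega> = {w \<in> L2 \<Omega>. \<exists>g \<in> L2 \<Omega>. has_weak_gradient \<Omega> w g}"

definition wgrad :: "(real^'n) set \<Rightarrow> (real^'n \<Rightarrow> real) \<Rightarrow> real^'n \<Rightarrow> real^'n" where
  "wgrad \<Omega> w = (SOME g. g \<in> L2 \<Omega> \<and> has_weak_gradient \<Omega> w g)"

definition H1_norm :: "(real^'n) set \<Rightarrow> (real^'n \<Rightarrow> real) \<Rightarrow> real" where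
  "H1_norm \<Omega> w = sqrt ((L2_norm \<Omega> w)\<^sup>2 + (L2_norm \<Omega> (wgrad \<Omega> w))\<^sup>2)"

definition H01 :: "(real^'n) set \<Rightarrow> (real^'n \<Rightarrow> real) set" where
  "H01 \<Omega> = {w \<in> H1 \<Omega>. \<exists>\<phi> D. (\<forall>k::nat. test_fun \<Omega> (\<phi> k) (D k)) \<and>
     (\<lambda>k. L2_norm \<Omega> (\<lambda>x. w x - \<phi> k x)) \<longlonglongrightarrow> 0 \<and>
     (\<lambda>k. L2_norm \<Omega> (\<lambda>x. wgrad \<Omega> w x - D k x)) \<longlonglongrightarrow> 0}"


section \<open>Functionals on \<open>H01\<close>\<close>

text \<open>
  Elements of the dual of \<open>H01 \<Omega>\<close> are functions \<open>F\<close> of the test element, so that \<open>F v\<close> is the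
  duality pairing of \<open>F\<close> with \<open>v\<close>, and \<open>L2_inner \<Omega> w\<close> is the functional identified with \<open>w\<close>.
  If \<open>\<Omega>\<close> is bounded, the integrability condition on \<open>v\<close> below is void; in general it admits
  bounded \<open>g\<close> that are not square integrable.
\<close>

type_synonym 'n functional = "(real^'n \<Rightarrow> real) \<Rightarrow> real"

definition represented_by ::
    "(real^'n) set \<Rightarrow> 'n functional \<Rightarrow> (real^'n \<Rightarrow> real) \<Rightarrow> bool" where
  "represented_by \<Omega> F g \<longleftrightarrow> g \<in> borel_measurable (lebesgue_on \<Omega>) \<and>
     (\<forall>v \<in> H01 \<Omega>. integrable (lebesgue_on \<Omega>) v \<longrightarrow>
        integrable (lebesgue_on \<Omega>) (\<lambda>x. g x * v x) \<and> F v = L2_inner \<Omega> g v)"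

text \<open>
  The function representing a functional is unique up to null sets, so the infimum only serves to
  assign the value \<open>\<infinity>\<close> to functionals that are not represented by a function.
\<close>

definition Linf_norm_functional :: "(real^'n) set \<Rightarrow> 'n functional \<Rightarrow> ennreal" where
  "Linf_norm_functional \<Omega> F = Inf {Linf_norm \<Omega> g | g. represented_by \<Omega> F g}"


section \<open>Elliptic operators\<close>

text \<open>
  The operator is \<open>w \<mapsto> - div (A \<nabla>w + w b) + c \<cdot> \<nabla>w + d w\<close> with bounded measurable coefficients.
\<close>

record ('n::finite) operator_coeffs =
  coeff_A :: "real^'n \<Rightarrow> real^'n^'n"
  coeff_b :: "real^'n \<Rightarrow> real^'n"
  coeff_c :: "real^'n \<Rightarrow> real^'n"
  coeff_d :: "real^'n \<Rightarrow> real"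

definition bounded_coeff :: "(real^'n) set \<Rightarrow> (real^'n \<Rightarrow> 'b::euclidean_space) \<Rightarrow> bool" where
  "bounded_coeff \<Omega> a \<longleftrightarrow> a \<in> borel_measurable (lebesgue_on \<Omega>) \<and>
     (\<exists>C. AE x in lebesgue_on \<Omega>. norm (a x) \<le> C)"

definition elliptic :: "(real^'n) set \<Rightarrow> 'n operator_coeffs \<Rightarrow> bool" where
  "elliptic \<Omega> L \<longleftrightarrow> bounded_coeff \<Omega> (coeff_A L) \<and> bounded_coeff \<Omega> (coeff_b L) \<and>
     bounded_coeff \<Omega> (coeff_c L) \<and> bounded_coeff \<Omega> (coeff_d L) \<and>
     (\<exists>\<alpha>>0. AE x in lebesgue_on \<Omega>. \<forall>\<xi>. \<xi> \<bullet> (coeff_A L x *v \<xi>) \<ge> \<alpha> * (norm \<xi>)\<^sup>2)"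

definition weak_op ::
    "(real^'n) set \<Rightarrow> 'n operator_coeffs \<Rightarrow> (real^'n \<Rightarrow> real) \<Rightarrow> 'n functional" where
  "weak_op \<Omega> L w v = (LINT x|lebesgue_on \<Omega>.
     (coeff_A L x *v wgrad \<Omega> w x + w x *\<^sub>R coeff_b L x) \<bullet> wgrad \<Omega> v x
       + (coeff_c L x \<bullet> wgrad \<Omega> w x) * v x + coeff_d L x * w x * v x)"

definition weak_adjoint ::
    "(real^'n) set \<Rightarrow> 'n operator_coeffs \<Rightarrow> (real^'n \<Rightarrow> real) \<Rightarrow> 'n functional" where
  "weak_adjoint \<Omega> L v w = weak_op \<Omega> L w v"


section \<open>The space \<open>W\<^sup>1\<^sup>,\<^sup>1([0,T], H01)\<close>\<close>

definition simple_integral_fun ::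
    "real set \<Rightarrow> (real \<Rightarrow> real^'n \<Rightarrow> real) \<Rightarrow> real^'n \<Rightarrow> real" where
  "simple_integral_fun S s =
     (\<lambda>x. \<Sum>z\<in>s ` S. measure lebesgue {r\<in>S. s r = z} * z x)"

text \<open>\<open>y\<close> is the Bochner integral over \<open>S\<close> of the \<open>H01 \<Omega>\<close>-valued function \<open>g\<close>.\<close>

definition has_H01_integral ::
    "(real^'n) set \<Rightarrow> real set \<Rightarrow> (real \<Rightarrow> real^'n \<Rightarrow> real) \<Rightarrow> (real^'n \<Rightarrow> real) \<Rightarrow> bool" where
  "has_H01_integral \<Omega> S g y \<longleftrightarrow> y \<in> H01 \<Omega> \<and>
     (AE r in lebesgue_on S. g r \<in> H01 \<Omega>) \<and>
     (\<exists>s. (\<forall>k::nat. simple_function (lebesgue_on S) (s k) \<and> s k ` S \<subseteq> H01 \<Omega>) \<and>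
        (AE r in lebesgue_on S. (\<lambda>k. H1_norm \<Omega> (\<lambda>x. s k r x - g r x)) \<longlonglongrightarrow> 0) \<and>
        (\<lambda>k. \<integral>\<^sup>+r. ennreal (H1_norm \<Omega> (\<lambda>x. s k r x - g r x)) \<partial>lebesgue_on S) \<longlonglongrightarrow> 0 \<and>
        (\<lambda>k. H1_norm \<Omega> (\<lambda>x. simple_integral_fun S (s k) x - y x)) \<longlonglongrightarrow> 0)"

text \<open>
  \<open>w\<close> is (the continuous representative of) an element of \<open>W\<^sup>1\<^sup>,\<^sup>1([0,T], H01)\<close> and \<open>w'\<close> is its time
  derivative: \<open>w' \<in> L\<^sup>1\<close> and \<open>w(t) - w(0)\<close> is the integral of \<open>w'\<close> over \<open>[0,t]\<close>.
\<close>

definition W11_H01 ::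
    "(real^'n) set \<Rightarrow> real \<Rightarrow> (real \<Rightarrow> real^'n \<Rightarrow> real) \<Rightarrow> (real \<Rightarrow> real^'n \<Rightarrow> real) \<Rightarrow> bool" where
  "W11_H01 \<Omega> T w w' \<longleftrightarrow>
     (\<forall>t\<in>{0..T}. w t \<in> H01 \<Omega> \<and> has_H01_integral \<Omega> {0..t} w' (\<lambda>x. w t x - w 0 x))"

text \<open>The functional \<open>(K w)(s) = w'(s) + L w(s)\<close>, where \<open>w'\<close> is the time derivative of \<open>w\<close>.\<close>

definition parabolic_op ::
    "(real^'n) set \<Rightarrow> 'n operator_coeffs \<Rightarrow> (real \<Rightarrow> real^'n \<Rightarrow> real) \<Rightarrow>
     (real \<Rightarrow> real^'n \<Rightarrow> real) \<Rightarrow> real \<Rightarrow> 'n functional" where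
  "parabolic_op \<Omega> L w w' s v = L2_inner \<Omega> (w' s) v + weak_op \<Omega> L (w s) v"

definition parabolic_solution ::
    "(real^'n) set \<Rightarrow> real \<Rightarrow> 'n operator_coeffs \<Rightarrow> (real \<Rightarrow> real^'n \<Rightarrow> real) \<Rightarrow>
     (real^'n \<Rightarrow> real) \<Rightarrow> (real \<Rightarrow> real^'n \<Rightarrow> real) \<Rightarrow> bool" where
  "parabolic_solution \<Omega> T L f u0 u \<longleftrightarrow>
     (\<exists>u'. W11_H01 \<Omega> T u u' \<and>
        (AE t in lebesgue_on {0..T}. \<forall>v \<in> H01 \<Omega>. parabolic_op \<Omega> L u u' t v = L2_inner \<Omega> (f t) v)) \<and>
     (AE x in lebesgue_on \<Omega>. u 0 x = u0 x)"


section \<open>Green's function\<close>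

definition has_L1_time_deriv ::
    "(real^'n) set \<Rightarrow> (real \<Rightarrow> real^'n \<Rightarrow> real) \<Rightarrow> (real^'n \<Rightarrow> real) \<Rightarrow> real \<Rightarrow> bool" where
  "has_L1_time_deriv \<Omega> w g t \<longleftrightarrow> integrable (lebesgue_on \<Omega>) g \<and>
     ((\<lambda>h. L1_norm \<Omega> (\<lambda>y. (w (t + h) y - w t y) / h - g y)) \<longlongrightarrow> 0) (at 0)"

text \<open>
  \<open>G x t y\<close> is the Green's function with pole \<open>x\<close>, and \<open>dG\<close> its time derivative.
  The last condition is the initial condition \<open>G(0) = \<delta>\<^sub>x\<close>.
\<close>

definition green_function ::
    "(real^'n) set \<Rightarrow> 'n operator_coeffs \<Rightarrow> (real^'n \<Rightarrow> real \<Rightarrow> real^'n \<Rightarrow> real) \<Rightarrow>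
     (real^'n \<Rightarrow> real \<Rightarrow> real^'n \<Rightarrow> real) \<Rightarrow> bool" where
  "green_function \<Omega> L G dG \<longleftrightarrow> (\<forall>x\<in>\<Omega>.
     (\<forall>t>0. G x t \<in> H01 \<Omega> \<and> integrable (lebesgue_on \<Omega>) (G x t) \<and>
        has_L1_time_deriv \<Omega> (G x) (dG x t) t \<and>
        (\<forall>\<phi> D. test_fun \<Omega> \<phi> D \<longrightarrow>
           L2_inner \<Omega> (dG x t) \<phi> + weak_adjoint \<Omega> L (G x t) \<phi> = 0)) \<and>
     (\<forall>\<phi> D. test_fun \<Omega> \<phi> D \<longrightarrow> ((\<lambda>t. L2_inner \<Omega> (G x t) \<phi>) \<longlongrightarrow> \<phi> x) (at_right 0)))"

text \<open>
  Functions in \<open>H01 \<Omega>\<close> are only defined up to null sets, so the representation is asserted for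
  almost all \<open>x\<close>.
\<close>

definition green_representation ::
    "(real^'n) set \<Rightarrow> real \<Rightarrow> 'n operator_coeffs \<Rightarrow> (real^'n \<Rightarrow> real \<Rightarrow> real^'n \<Rightarrow> real) \<Rightarrow> bool"
  where
  "green_representation \<Omega> T L G \<longleftrightarrow>
     (\<forall>w w'. W11_H01 \<Omega> T w w' \<longrightarrow> (\<forall>t\<in>{0<..T}. AE x in lebesgue_on \<Omega>.
        integrable (lebesgue_on {0<..<t}) (\<lambda>s. parabolic_op \<Omega> L w w' s (G x (t - s))) \<and>
        w t x = L2_inner \<Omega> (G x t) (w 0)
          + (LINT s|lebesgue_on {0<..<t}. parabolic_op \<Omega> L w w' s (G x (t - s)))))"

definition green_bounds ::
    "(real^'n) set \<Rightarrow> real \<Rightarrow> (real^'n \<Rightarrow> real \<Rightarrow> real^'n \<Rightarrow> real) \<Rightarrow>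
     (real^'n \<Rightarrow> real \<Rightarrow> real^'n \<Rightarrow> real) \<Rightarrow> real \<Rightarrow> real \<Rightarrow> real \<Rightarrow> real \<Rightarrow> bool" where
  "green_bounds \<Omega> T G dG \<kappa>\<^sub>0 \<kappa>\<^sub>1 \<kappa>\<^sub>1' \<gamma> \<longleftrightarrow> \<kappa>\<^sub>0 \<ge> 0 \<and> \<kappa>\<^sub>1 \<ge> 0 \<and> \<kappa>\<^sub>1' \<ge> 0 \<and> \<gamma> \<ge> 0 \<and>
     (\<forall>x\<in>\<Omega>. \<forall>t\<in>{0<..T}.
        L1_norm \<Omega> (G x t) \<le> ennreal (\<kappa>\<^sub>0 * exp (- \<gamma> * t)) \<and>
        L1_norm \<Omega> (dG x t) \<le> ennreal ((\<kappa>\<^sub>1 / t + \<kappa>\<^sub>1') * exp (- \<gamma> * t)))"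


section \<open>Crank--Nicolson discretisation and error estimators\<close>

definition mesh :: "real \<Rightarrow> nat \<Rightarrow> (nat \<Rightarrow> real) \<Rightarrow> bool" where
  "mesh T M t \<longleftrightarrow> t 0 = 0 \<and> t M = T \<and> (\<forall>j<M. t j < t (Suc j))"

definition step :: "(nat \<Rightarrow> real) \<Rightarrow> nat \<Rightarrow> real" where
  "step t j = t j - t (j - 1)"

text \<open>The difference quotient is used both for functions and for functionals.\<close>

definition delta_t :: "(nat \<Rightarrow> real) \<Rightarrow> (nat \<Rightarrow> 'a \<Rightarrow> real) \<Rightarrow> nat \<Rightarrow> 'a \<Rightarrow> real" where
  "delta_t t v j = (\<lambda>x. (v j x - v (j - 1) x) / step t j)"

text \<open>The restriction of the piecewise linear interpolant of \<open>f\<close> to \<open>[t (j - 1), t j]\<close>.\<close>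

definition lin_interp ::
    "(nat \<Rightarrow> real) \<Rightarrow> (real \<Rightarrow> real^'n \<Rightarrow> real) \<Rightarrow> nat \<Rightarrow> real \<Rightarrow> real^'n \<Rightarrow> real" where
  "lin_interp t f j s = (\<lambda>x. f (t j) x - (t j - s) * delta_t t (\<lambda>i. f (t i)) j x)"

definition crank_nicolson ::
    "(real^'n) set \<Rightarrow> 'n operator_coeffs \<Rightarrow> (real \<Rightarrow> real^'n \<Rightarrow> real) \<Rightarrow> (real^'n \<Rightarrow> real) \<Rightarrow>
     nat \<Rightarrow> (nat \<Rightarrow> real) \<Rightarrow> (nat \<Rightarrow> real^'n \<Rightarrow> real) \<Rightarrow> bool" where
  "crank_nicolson \<Omega> L f u0 M t U \<longleftrightarrow>
     (\<forall>j\<le>M. U j \<in> H01 \<Omega>) \<and> (AE x in lebesgue_on \<Omega>. U 0 x = u0 x) \<and>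
     (\<forall>j\<in>{1..M}. \<forall>v\<in>H01 \<Omega>.
        L2_inner \<Omega> (\<lambda>x. (U j x - U (j - 1) x) / step t j) v
          + (weak_op \<Omega> L (U j) v + weak_op \<Omega> L (U (j - 1)) v) / 2
        = L2_inner \<Omega> (\<lambda>x. (f (t j) x + f (t (j - 1)) x) / 2) v)"

definition psi ::
    "(real^'n) set \<Rightarrow> 'n operator_coeffs \<Rightarrow> (real \<Rightarrow> real^'n \<Rightarrow> real) \<Rightarrow>
     (nat \<Rightarrow> real) \<Rightarrow> (nat \<Rightarrow> real^'n \<Rightarrow> real) \<Rightarrow> nat \<Rightarrow> 'n functional" where
  "psi \<Omega> L f t U j = (\<lambda>v. weak_op \<Omega> L (U j) v - L2_inner \<Omega> (f (t j)) v)"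

definition Phi1 :: "real \<Rightarrow> real \<Rightarrow> real \<Rightarrow> (nat \<Rightarrow> real) \<Rightarrow> nat \<Rightarrow> real" where
  "Phi1 \<kappa>\<^sub>1 \<kappa>\<^sub>1' T t j =
     \<kappa>\<^sub>1 * integral {t (j - 1)..t j} (\<lambda>s. (t j - s) * (s - t (j - 1)) / (T - s))
       + \<kappa>\<^sub>1' * (step t j ^ 3 / 6)"

definition Phi1_star :: "real \<Rightarrow> (nat \<Rightarrow> real) \<Rightarrow> nat \<Rightarrow> real" where
  "Phi1_star \<kappa>\<^sub>0 t j =
     \<kappa>\<^sub>0 * integral {t (j - 1)..t j} (\<lambda>s. \<bar>deriv (\<lambda>r. (t j - r) * (r - t (j - 1))) s\<bar>)"

definition Psi1 :: "real \<Rightarrow> real \<Rightarrow> real \<Rightarrow> real \<Rightarrow> (nat \<Rightarrow> real) \<Rightarrow> nat \<Rightarrow> real" where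
  "Psi1 \<kappa>\<^sub>0 \<kappa>\<^sub>1 \<kappa>\<^sub>1' T t j = min (Phi1 \<kappa>\<^sub>1 \<kappa>\<^sub>1' T t j) (Phi1_star \<kappa>\<^sub>0 t j)"

definition eta_f ::
    "(real^'n) set \<Rightarrow> real \<Rightarrow> (nat \<Rightarrow> real) \<Rightarrow> (real \<Rightarrow> real^'n \<Rightarrow> real) \<Rightarrow> nat \<Rightarrow> ennreal" where
  "eta_f \<Omega> \<kappa>\<^sub>0 t f j = ennreal \<kappa>\<^sub>0 *
     (\<integral>\<^sup>+s. Linf_norm \<Omega> (\<lambda>x. f s x - lin_interp t f j s x) \<partial>lebesgue_on {t (j - 1)<..<t j})"

definition eta_psi ::
    "(real^'n) set \<Rightarrow> 'n operator_coeffs \<Rightarrow> real \<Rightarrow> real \<Rightarrow> real \<Rightarrow> real \<Rightarrow>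
     (real \<Rightarrow> real^'n \<Rightarrow> real) \<Rightarrow> (nat \<Rightarrow> real) \<Rightarrow> (nat \<Rightarrow> real^'n \<Rightarrow> real) \<Rightarrow> nat \<Rightarrow> ennreal" where
  "eta_psi \<Omega> L \<kappa>\<^sub>0 \<kappa>\<^sub>1 \<kappa>\<^sub>1' T f t U j = ennreal (Psi1 \<kappa>\<^sub>0 \<kappa>\<^sub>1 \<kappa>\<^sub>1' T t j / 2) *
     Linf_norm_functional \<Omega> (delta_t t (psi \<Omega> L f t U) j)"

end

theory Submission
  imports Defs
begin

text \<open>
  Let \<open>V\<close> be the piecewise linear interpolant in time of the approximations
  \<open>U\<^sup>j\<close> (\<open>pl_interp\<close>). The error \<open>u - V\<close> vanishes at time 0 and
  equals \<open>u(T) - U\<^sup>M\<close> at time \<open>T\<close>, so the Green's function turns its residual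
  into a formula for \<open>u(T) - U\<^sup>M\<close>. On the \<open>j\<close>-th mesh interval
  \<open>\<L>V\<close> and the interpolant \<open>f\<^sub>I\<close> of \<open>f\<close> are linear in time and
  the Crank--Nicolson equation says that \<open>\<delta>\<^sub>tU\<^sup>j\<close> is minus the value of
  \<open>\<L>V - f\<^sub>I\<close> at the midpoint \<open>m\<^sub>j\<close> of the interval. Therefore the
  residual is \<open>(f - f\<^sub>I)(s) + (m\<^sub>j - s) \<delta>\<^sub>t\<psi>\<^sup>j\<close>
  (\<open>crank_nicolson_residual\<close>).

  The first term is tested with \<open>\<G>(T - s)\<close> and estimated by the duality of
  \<open>L\<^sub>1\<close> and \<open>L\<^sub>\<infinity>\<close>, which gives the first part of the
  estimator. For the second one, \<open>m\<^sub>j - s\<close> is half the derivative of the bubble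
  \<open>(t\<^sub>j - s)(s - t\<^sub>j\<^sub>-\<^sub>1)\<close>, which vanishes at both ends of the interval.
  Either the absolute value of this derivative is integrated directly against the bound for
  \<open>\<G>\<close> (\<open>midpoint_weight_bound\<close>), or the derivative is moved to
  \<open>\<G>\<close> by parts (\<open>by_parts_bound\<close>): the factor \<open>1/(T - s)\<close> in the
  bound for \<open>\<partial>\<^sub>t\<G>\<close> is compensated by the zero of the bubble at \<open>T\<close>
  on the last interval. The better of the two estimates is the minimum in
  \<open>\<Psi>\<^sub>1\<^sub>,\<^sub>j\<close>, and \<open>green_interval_bound\<close> collects the
  contributions of one interval.

  Three points need more care than this sketch shows. The interpolant must be an admissible argument of the
  representation formula. This rests on the linear structure of \<open>H01\<close> and of the weak operator,
  hence on the uniqueness of weak gradients (\<open>L2_eq_0_if_orthogonal_to_test_funs\<close>). For the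
  Bochner integral, the derivative of \<open>V\<close> is a step function and can be subtracted from the
  approximating simple functions. Next, \<open>\<delta>\<^sub>t\<psi>\<^sup>j\<close> is only a functional,
  whose \<open>L\<^sub>\<infinity>\<close> norm may be infinite. Since \<open>0 \<cdot> \<infinity> =
  0\<close>, the estimator would be meaningless if \<open>\<Psi>\<^sub>1\<^sub>,\<^sub>j\<close> could vanish;
  it cannot, because otherwise the Green's function would be constant in time or zero, and a square integrable
  function cannot represent the Dirac distribution (\<open>no_L2_delta\<close>,
  \<open>green_constants_pos\<close>). Finally the norm of \<open>(f - f\<^sub>I)(s)\<close> need not be
  measurable in \<open>s\<close>; the measurable quantity to be estimated lies below it
  (\<open>interval_contribution_bound\<close>), which is all that the lower integral requires.
\<close>


section \<open>Test functions approximating indicators of compact sets\<close>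

lemma has_real_derivative_max_0_sq:
  "((\<lambda>s::real. (max 0 s)\<^sup>2) has_real_derivative 2 * max 0 s) (at s)"
proof (cases s "0::real" rule: linorder_cases)
  case less
  have "((\<lambda>s::real. 0) has_real_derivative 2 * max 0 s) (at s)"
    using less by (auto intro!: derivative_eq_intros)
  moreover have "eventually (\<lambda>r::real. 0 = (max 0 r)\<^sup>2) (nhds s)"
    using eventually_nhds_in_open[of "{..<0}" s] less by (auto elim!: eventually_mono)
  ultimately show ?thesis
    using DERIV_cong_ev[OF refl, of "\<lambda>_. 0" "\<lambda>r. (max 0 r)\<^sup>2" s] by metis
next
  case equal
  have "((\<lambda>h::real. (max 0 h)\<^sup>2 / h) \<longlongrightarrow> 0) (at 0)"
  proof (rule Lim_null_comparison[where g="\<lambda>h. \<bar>h\<bar>"])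
    show "\<forall>\<^sub>F h in at 0. norm ((max 0 h)\<^sup>2 / h) \<le> \<bar>h\<bar>"
      by (rule always_eventually) (auto simp: max_def power2_eq_square)
    show "((\<lambda>h::real. \<bar>h\<bar>) \<longlongrightarrow> 0) (at 0)" by (rule tendsto_rabs_zero) simp
  qed
  then show ?thesis using equal by (simp add: DERIV_def)
next
  case greater
  have "((\<lambda>s::real. s\<^sup>2) has_real_derivative 2 * max 0 s) (at s)"
    using greater by (auto intro!: derivative_eq_intros)
  moreover have "eventually (\<lambda>r::real. r\<^sup>2 = (max 0 r)\<^sup>2) (nhds s)"
    using eventually_nhds_in_open[of "{0<..}" s] greater by (auto elim!: eventually_mono)
  ultimately show ?thesis
    using DERIV_cong_ev[OF refl, of "\<lambda>r. r\<^sup>2" "\<lambda>r. (max 0 r)\<^sup>2" s] by metis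
qed

text \<open>
  Squaring the positive part makes the bump continuously differentiable across the sphere; it is positive
  exactly on the open ball, where the argument of the positive part is positive.
\<close>

lemma C1_bump_on_ball:
  fixes c :: "'a::euclidean_space"
  obtains D where "\<And>x. ((\<lambda>x. (max 0 (r\<^sup>2 - (x - c) \<bullet> (x - c)))\<^sup>2) has_derivative (\<lambda>h. D x \<bullet> h)) (at x)"
    and "continuous_on UNIV D"
proof
  let ?s = "\<lambda>x. r\<^sup>2 - (x - c) \<bullet> (x - c)"
  let ?D = "\<lambda>x. (2 * max 0 (?s x) * (-2)) *\<^sub>R (x - c)"
  show "((\<lambda>x. (max 0 (?s x))\<^sup>2) has_derivative (\<lambda>h. ?D x \<bullet> h)) (at x)" for x
  proof -
    have "(?s has_derivative (\<lambda>h. -2 * ((x - c) \<bullet> h))) (at x)"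
      by (auto intro!: derivative_eq_intros simp: inner_commute)
    from has_derivative_compose[OF this, of "\<lambda>s. (max 0 s)\<^sup>2" "\<lambda>h. (2 * max 0 (?s x)) * h"]
      has_real_derivative_max_0_sq[of "?s x"]
    have "((\<lambda>x. (max 0 (?s x))\<^sup>2) has_derivative (\<lambda>h. (2 * max 0 (?s x)) * (-2 * ((x - c) \<bullet> h)))) (at x)"
      by (simp only: has_field_derivative_def)
    then show ?thesis by (simp only: inner_scaleR_left mult.assoc)
  qed
  show "continuous_on UNIV ?D"
    by (intro continuous_intros)
qed

text \<open>
  Cover \<open>K\<close> by finitely many small balls and add their bumps to a function \<open>R\<close>,
  which is bounded below by some \<open>m > 0\<close> on \<open>K\<close>. Then \<open>1 - exp (- k R /
  m)\<close> is at least \<open>1 - exp (- k)\<close> on \<open>K\<close> and vanishes outside the balls;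
  letting the radius tend to zero with \<open>1 / k\<close> gives the indicator in the limit. The common
  compact support \<open>K'\<close> provides a dominating function for integrands that are only locally
  integrable.
\<close>

lemma compact_indicator_limit_of_test_funs:
  fixes \<Omega> :: "(real^'n) set"
  assumes "open \<Omega>" "compact K" "K \<subseteq> \<Omega>"
  obtains \<phi> D K' where "\<And>k::nat. test_fun \<Omega> (\<phi> k) (D k)"
    "\<And>k x. 0 \<le> \<phi> k x" "\<And>k x. \<phi> k x \<le> 1" "compact K'" "K' \<subseteq> \<Omega>" "\<And>k x. x \<notin> K' \<Longrightarrow> \<phi> k x = 0"
    "\<And>x. (\<lambda>k. \<phi> k x) \<longlonglongrightarrow> indicator K x"
proof -
  obtain e where e: "e > 0" "(\<Union>x\<in>K. cball x e) \<subseteq> \<Omega>"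
    using compact_subset_open_imp_cball_epsilon_subset[OF assms(2,1,3)] by blast
  define K' where "K' = (\<Union>x\<in>K. cball x e)"
  have K': "compact K'"
  proof -
    have "K' = (\<Union>x\<in>K. \<Union>y\<in>cball 0 e. {x + y})"
      unfolding K'_def
      by (force simp: dist_norm norm_minus_commute intro: bexI[where x="_ - _"])
    then show ?thesis using compact_sums'[OF assms(2) compact_cball, of 0 e] by auto
  qed
  define \<rho> where "\<rho> r c x = (max 0 (r\<^sup>2 - (x - c) \<bullet> (x - c)))\<^sup>2" for r and c x :: "real^'n"
  have \<rho>0: "\<rho> r c x \<ge> 0" for r c x by (simp add: \<rho>_def)
  have \<rho>pos: "\<rho> r c x > 0 \<longleftrightarrow> dist c x < r" if "r > 0" for r c x
  proof -
    have "(x - c) \<bullet> (x - c) < r\<^sup>2 \<longleftrightarrow> dist c x < r"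
      using that by (simp add: power2_norm_eq_inner[symmetric] dist_norm norm_minus_commute
        abs_square_less_1 power2_less_imp_less power_strict_mono power_mono_iff flip: not_le)
    then show ?thesis by (auto simp: \<rho>_def max_def)
  qed
  have ex: "\<exists>\<phi> D. test_fun \<Omega> \<phi> D \<and> (\<forall>x. 0 \<le> \<phi> x \<and> \<phi> x \<le> 1 \<and> (x \<notin> K' \<longrightarrow> \<phi> x = 0) \<and>
      (x \<in> K \<longrightarrow> \<phi> x \<ge> 1 - exp (- real k)) \<and> ((\<forall>y\<in>K. dist y x \<ge> 1 / (1 + real k)) \<longrightarrow> \<phi> x = 0))" for k :: nat
  proof -
    define r where "r = min e (1 / (1 + real k))"
    have r: "r > 0" using e by (simp add: r_def)
    have cov: "K \<subseteq> (\<Union>c\<in>K. ball c r)" using r by auto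
    obtain C where C: "C \<subseteq> K" "finite C" "K \<subseteq> (\<Union>c\<in>C. ball c r)"
      using compactE_image[OF assms(2) _ cov] by blast
    define R where "R x = (\<Sum>c\<in>C. \<rho> r c x)" for x
    have "\<exists>D. (\<forall>x. (\<rho> r c has_derivative (\<lambda>h. D x \<bullet> h)) (at x)) \<and> continuous_on UNIV D" for c
    proof -
      have "\<rho> r c = (\<lambda>x. (max 0 (r\<^sup>2 - (x - c) \<bullet> (x - c)))\<^sup>2)" by (simp add: \<rho>_def fun_eq_iff)
      then show ?thesis by (rule_tac C1_bump_on_ball[of r c]) auto
    qed
    then obtain d where d: "\<And>c x. (\<rho> r c has_derivative (\<lambda>h. d c x \<bullet> h)) (at x)" "\<And>c. continuous_on UNIV (d c)"
      using choice[of "\<lambda>c D. (\<forall>x. (\<rho> r c has_derivative (\<lambda>h. D x \<bullet> h)) (at x)) \<and> continuous_on UNIV D"] by blast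
    define DR where "DR x = (\<Sum>c\<in>C. d c x)" for x
    have DR: "(R has_derivative (\<lambda>h. DR x \<bullet> h)) (at x)" for x
      unfolding R_def DR_def inner_sum_left by (intro has_derivative_sum d)
    have DRc: "continuous_on UNIV DR" unfolding DR_def by (intro continuous_intros d)
    have Rc: "continuous_on UNIV R"
      using DR by (meson continuous_at_imp_continuous_on has_derivative_continuous)
    have R0: "R x \<ge> 0" for x unfolding R_def by (intro sum_nonneg \<rho>0)
    have RK: "R x > 0" if "x \<in> K" for x
    proof -
      obtain c where c: "c \<in> C" "dist c x < r" using subsetD[OF C(3) \<open>x \<in> K\<close>] by auto
      then show ?thesis unfolding R_def
        using \<rho>pos[OF r] by (intro sum_pos2[OF C(2)]) (auto simp: \<rho>0)
    qed
    have Rz: "R x = 0" if "\<forall>y\<in>K. dist y x \<ge> r" for x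
      unfolding R_def
    proof (intro sum.neutral ballI)
      fix c assume "c \<in> C"
      then have "\<not> dist c x < r" using that C(1) by force
      then show "\<rho> r c x = 0" using \<rho>pos[OF r, of c x] \<rho>0[of r c x] by linarith
    qed
    obtain m where m: "m > 0" "\<And>x. x \<in> K \<Longrightarrow> m \<le> R x"
    proof (cases "K = {}")
      case True then show ?thesis using that[of 1] by auto
    next
      case False
      obtain x where "x \<in> K" "\<forall>y\<in>K. R x \<le> R y"
        using continuous_attains_inf[OF assms(2) False continuous_on_subset[OF Rc]] by auto
      then show ?thesis using that[of "R x"] RK by auto
    qed
    \<comment> \<open>This factor makes the exponent at most \<open>- k\<close> where \<open>R \<ge> m\<close>.\<close>
    define a where "a = real k / m"
    define \<phi> where "\<phi> x = 1 - exp (- (a * R x))" for x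
    define D where "D x = (a * exp (- (a * R x))) *\<^sub>R DR x" for x
    have a: "a \<ge> 0" using m by (simp add: a_def)
    have supp: "x \<in> K'" if "\<phi> x \<noteq> 0" for x
    proof (rule ccontr)
      assume "x \<notin> K'"
      then have "\<forall>y\<in>K. dist y x \<ge> r" unfolding K'_def r_def by auto
      from Rz[OF this] that show False by (simp add: \<phi>_def)
    qed
    then have cl: "closure {x. \<phi> x \<noteq> 0} \<subseteq> K'"
      using K' by (intro closure_minimal) (auto intro: compact_imp_closed)
    have "test_fun \<Omega> \<phi> D"
      unfolding test_fun_def
    proof (intro conjI allI)
      show "(\<phi> has_derivative (\<lambda>h. D x \<bullet> h)) (at x)" for x
        unfolding \<phi>_def D_def
        by (rule derivative_eq_intros DR refl)+ (auto simp: algebra_simps)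
      show "continuous_on UNIV D" unfolding D_def by (intro continuous_intros DRc Rc)
      show "closure {x. \<phi> x \<noteq> 0} \<subseteq> \<Omega>" using cl e K'_def by auto
      show "compact (closure {x. \<phi> x \<noteq> 0})"
        using compact_Int_closed[OF K' closed_closure, of "{x. \<phi> x \<noteq> 0}"] cl by (simp add: inf.absorb2)
    qed
    moreover have "\<phi> x \<ge> 1 - exp (- real k)" if "x \<in> K" for x
    proof -
      have "real k \<le> a * R x"
        using mult_left_mono[OF m(2)[OF that], of "real k"] m(1) by (simp add: a_def field_simps)
      then show ?thesis by (simp add: \<phi>_def)
    qed
    moreover have "\<phi> x = 0" if "\<forall>y\<in>K. dist y x \<ge> 1 / (1 + real k)" for x
      using Rz[of x] that unfolding \<phi>_def r_def by force
    moreover have "0 \<le> \<phi> x \<and> \<phi> x \<le> 1" for x using a R0[of x] by (simp add: \<phi>_def)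
    ultimately show ?thesis using supp by blast
  qed
  then obtain \<phi> D where \<phi>: "\<And>k. test_fun \<Omega> (\<phi> k) (D k)"
     "\<And>k x. 0 \<le> \<phi> k x" "\<And>k x. \<phi> k x \<le> 1" "\<And>k x. x \<notin> K' \<Longrightarrow> \<phi> k x = 0"
     "\<And>k x. x \<in> K \<Longrightarrow> \<phi> k x \<ge> 1 - exp (- real k)"
     "\<And>k x. (\<forall>y\<in>K. dist y x \<ge> 1 / (1 + real k)) \<Longrightarrow> \<phi> k x = 0" by metis
  have "(\<lambda>k. \<phi> k x) \<longlonglongrightarrow> indicator K x" for x
  proof (cases "x \<in> K")
    case True
    have "(\<lambda>k. exp (- real k)) \<longlonglongrightarrow> 0"
      using filterlim_real_sequentially
      by (intro filterlim_compose[OF exp_at_bot] filterlim_compose[OF filterlim_uminus_at_bot_at_top])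
    from tendsto_diff[OF tendsto_const[of 1] this]
    have "(\<lambda>k. 1 - exp (- real k)) \<longlonglongrightarrow> 1" by simp
    from tendsto_sandwich[OF _ _ this tendsto_const[of 1], of "\<lambda>k. \<phi> k x"] True \<phi>
    show ?thesis by auto
  next
    case False
    obtain d where d: "d > 0" "ball x d \<subseteq> - K"
      using compact_imp_closed[OF assms(2)] False by (metis ComplI closed_open openE)
    have "eventually (\<lambda>k. 1 / (1 + real k) < d) sequentially"
      using order_tendstoD(2)[OF LIMSEQ_inverse_real_of_nat d(1)] by (simp add: inverse_eq_divide)
    then have "eventually (\<lambda>k. \<phi> k x = 0) sequentially"
    proof eventually_elim
      case (elim k)
      show ?case
        using d elim by (intro \<phi>(6) ballI) (force simp: dist_commute)
    qed
    then show ?thesis using False by (simp add: tendsto_eventually)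
  qed
  note lim = this
  have "K' \<subseteq> \<Omega>" using e(2) by (simp add: K'_def)
  from that[OF \<phi>(1-3) K' this \<phi>(4) lim] show ?thesis .
qed


section \<open>Square integrable functions\<close>

lemma integrable_L2_norm_sq: "w \<in> L2 \<Omega> \<Longrightarrow> integrable (lebesgue_on \<Omega>) (\<lambda>x. (norm (w x))\<^sup>2)"
  by (simp add: L2_def)

text \<open>
  This crude substitute for Minkowski's inequality suffices for the closure of \<open>L2\<close> under linear
  combinations and for the convergence of norms to zero.
\<close>

lemma norm_sq_lincomb_le:
  fixes v w :: "'a::real_normed_vector"
  shows "(norm (a *\<^sub>R v + b *\<^sub>R w))\<^sup>2 \<le> 2 * a\<^sup>2 * (norm v)\<^sup>2 + 2 * b\<^sup>2 * (norm w)\<^sup>2"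
proof -
  have "(norm (a *\<^sub>R v + b *\<^sub>R w))\<^sup>2 \<le> (\<bar>a\<bar> * norm v + \<bar>b\<bar> * norm w)\<^sup>2"
    by (intro power_mono norm_ge_zero) (metis norm_scaleR norm_triangle_ineq)
  also have "\<dots> \<le> 2 * (\<bar>a\<bar> * norm v)\<^sup>2 + 2 * (\<bar>b\<bar> * norm w)\<^sup>2"
    using sum_squares_bound[of "\<bar>a\<bar> * norm v" "\<bar>b\<bar> * norm w"] by (simp add: power2_sum)
  finally show ?thesis by (simp add: power_mult_distrib mult.assoc)
qed

lemma L2_lincomb:
  assumes "v \<in> L2 \<Omega>" "w \<in> L2 \<Omega>"
  shows "(\<lambda>x. a *\<^sub>R v x + b *\<^sub>R w x) \<in> L2 \<Omega>"
proof -
  have [measurable]: "v \<in> borel_measurable (lebesgue_on \<Omega>)" "w \<in> borel_measurable (lebesgue_on \<Omega>)"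
    using assms by (auto simp: L2_def)
  have "integrable (lebesgue_on \<Omega>) (\<lambda>x. (norm (a *\<^sub>R v x + b *\<^sub>R w x))\<^sup>2)"
    by (rule Bochner_Integration.integrable_bound[where f="\<lambda>x. 2 * a\<^sup>2 * (norm (v x))\<^sup>2 + 2 * b\<^sup>2 * (norm (w x))\<^sup>2"])
       (use assms norm_sq_lincomb_le in \<open>auto simp: L2_def intro!: AE_I2\<close>)
  then show ?thesis by (simp add: L2_def)
qed

lemma L2_lincomb_real:
  fixes v w :: "real^'n \<Rightarrow> real"
  assumes "v \<in> L2 \<Omega>" "w \<in> L2 \<Omega>"
  shows "(\<lambda>x. a * v x + b * w x) \<in> L2 \<Omega>"
  using L2_lincomb[OF assms, of a b] by simp

lemma L2_add: "v \<in> L2 \<Omega> \<Longrightarrow> w \<in> L2 \<Omega> \<Longrightarrow> (\<lambda>x. v x + w x) \<in> L2 \<Omega>"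
  using L2_lincomb[of v \<Omega> w 1 1] by simp

lemma L2_diff: "v \<in> L2 \<Omega> \<Longrightarrow> w \<in> L2 \<Omega> \<Longrightarrow> (\<lambda>x. v x - w x) \<in> L2 \<Omega>"
  using L2_lincomb[of v \<Omega> w 1 "-1"] by simp

lemma measurable_bounded_bilinear:
  fixes h :: "'a::euclidean_space \<Rightarrow> 'b::euclidean_space \<Rightarrow> 'c::euclidean_space"
  assumes "bounded_bilinear h" and "v \<in> borel_measurable N" and "w \<in> borel_measurable N"
  shows "(\<lambda>x. h (v x) (w x)) \<in> borel_measurable N"
  using assms(2,3)
  by (rule borel_measurable_continuous_Pair)
     (intro bounded_bilinear.continuous_on[OF assms(1)] continuous_intros)

lemma L2_bilinear_integrable:
  fixes h :: "'a::euclidean_space \<Rightarrow> 'b::euclidean_space \<Rightarrow> 'c::euclidean_space"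
  assumes h: "bounded_bilinear h" and v: "v \<in> L2 \<Omega>" and w: "w \<in> L2 \<Omega>"
  shows "integrable (lebesgue_on \<Omega>) (\<lambda>x. h (v x) (w x))"
proof -
  obtain C where C: "C > 0" "\<And>a b. norm (h a b) \<le> norm a * norm b * C"
    using bounded_bilinear.pos_bounded[OF h] by blast
  have "norm (h a b) \<le> norm (C * ((norm a)\<^sup>2 + (norm b)\<^sup>2))" for a b
  proof -
    have "norm a * norm b \<le> (norm a)\<^sup>2 + (norm b)\<^sup>2"
      using sum_squares_bound[of "norm a" "norm b"] mult_nonneg_nonneg[OF norm_ge_zero[of a] norm_ge_zero[of b]]
      by linarith
    then have "norm a * norm b * C \<le> ((norm a)\<^sup>2 + (norm b)\<^sup>2) * C"
      using C(1) by (intro mult_right_mono) auto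
    with C(2)[of a b] have "norm (h a b) \<le> C * ((norm a)\<^sup>2 + (norm b)\<^sup>2)"
      by (simp add: mult.commute)
    also have "\<dots> \<le> norm \<dots>" by simp
    finally show ?thesis .
  qed
  note bd = this
  show ?thesis
  proof (rule Bochner_Integration.integrable_bound[where f="\<lambda>x. C * ((norm (v x))\<^sup>2 + (norm (w x))\<^sup>2)"])
    show "(\<lambda>x. h (v x) (w x)) \<in> borel_measurable (lebesgue_on \<Omega>)"
      using v w by (intro measurable_bounded_bilinear[OF h]) (auto simp: L2_def)
  qed (use v w bd in \<open>auto simp: L2_def\<close>)
qed

lemmas L2_mult_integrable = L2_bilinear_integrable[OF bounded_bilinear_mult]

lemma L2_inner_lincomb:
  assumes "v \<in> L2 \<Omega>" "w \<in> L2 \<Omega>" "z \<in> L2 \<Omega>"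
  shows "L2_inner \<Omega> (\<lambda>x. a * v x + b * w x) z = a * L2_inner \<Omega> v z + b * L2_inner \<Omega> w z"
  using L2_mult_integrable[OF assms(1,3)] L2_mult_integrable[OF assms(2,3)]
  unfolding L2_inner_def by (simp add: distrib_right mult.assoc)

lemma L2_inner_diff:
  assumes "v \<in> L2 \<Omega>" "w \<in> L2 \<Omega>" "z \<in> L2 \<Omega>"
  shows "L2_inner \<Omega> (\<lambda>x. v x - w x) z = L2_inner \<Omega> v z - L2_inner \<Omega> w z"
  using L2_inner_lincomb[OF assms, of 1 "- 1"] by simp

lemma L2_bounded_coeff:
  fixes h :: "'a::euclidean_space \<Rightarrow> 'b::euclidean_space \<Rightarrow> 'c::euclidean_space"
  assumes h: "bounded_bilinear h" and a: "bounded_coeff \<Omega> a" and w: "w \<in> L2 \<Omega>"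
  shows "(\<lambda>x. h (a x) (w x)) \<in> L2 \<Omega>"
proof -
  obtain B where B: "B > 0" "\<And>a b. norm (h a b) \<le> norm a * norm b * B"
    using bounded_bilinear.pos_bounded[OF h] by blast
  obtain C where C: "AE x in lebesgue_on \<Omega>. norm (a x) \<le> C"
    and [measurable]: "a \<in> borel_measurable (lebesgue_on \<Omega>)"
    using a by (auto simp: bounded_coeff_def)
  have [measurable]: "(\<lambda>x. h (a x) (w x)) \<in> borel_measurable (lebesgue_on \<Omega>)"
    using w by (intro measurable_bounded_bilinear[OF h]) (auto simp: L2_def)
  have "integrable (lebesgue_on \<Omega>) (\<lambda>x. (norm (h (a x) (w x)))\<^sup>2)"
  proof (rule Bochner_Integration.integrable_bound[where f="\<lambda>x. (C * B)\<^sup>2 * (norm (w x))\<^sup>2"])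
    show "AE x in lebesgue_on \<Omega>. norm ((norm (h (a x) (w x)))\<^sup>2) \<le> norm ((C * B)\<^sup>2 * (norm (w x))\<^sup>2)"
      using C
    proof eventually_elim
      case (elim x)
      have "norm (a x) * norm (w x) * B \<le> C * norm (w x) * B"
        using elim B(1) by (intro mult_right_mono) auto
      with B(2)[of "a x" "w x"] have "norm (h (a x) (w x)) \<le> C * norm (w x) * B" by linarith
      from power_mono[OF this norm_ge_zero, of 2] show ?case
        by (simp add: power_mult_distrib mult.assoc mult.commute mult.left_commute)
    qed
  qed (use w in \<open>auto simp: L2_def\<close>)
  then show ?thesis by (simp add: L2_def)
qed

lemma continuous_compact_support_L2:
  fixes f :: "real^'n \<Rightarrow> 'b::euclidean_space"
  assumes "\<Omega> \<in> sets lebesgue" and f: "continuous_on UNIV f" and K: "compact K" "\<And>x. x \<notin> K \<Longrightarrow> f x = 0"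
  shows "f \<in> L2 \<Omega>"
proof -
  have m: "f \<in> borel_measurable (lebesgue_on \<Omega>)"
    using continuous_imp_measurable_on_sets_lebesgue[OF continuous_on_subset[OF f] assms(1)] by simp
  have mK: "K \<in> lmeasurable" using K by (simp add: lmeasurable_compact)
  obtain C where C: "\<And>x. x \<in> K \<Longrightarrow> norm (f x) \<le> C"
    using compact_imp_bounded[OF compact_continuous_image[OF continuous_on_subset[OF f] K(1)]]
    unfolding bounded_iff by auto
  have "integrable lebesgue (\<lambda>x. indicator K x *\<^sub>R C\<^sup>2)"
    using mK by (intro integrable_scaleR_left) (auto simp: fmeasurable_def)
  note i0 = integrable_mult_indicator[OF assms(1) this]
  have i: "integrable (lebesgue_on \<Omega>) (\<lambda>x. indicator K x *\<^sub>R C\<^sup>2)"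
    by (rule integrable_restrict_space[THEN iffD2, OF _ i0]) (use assms(1) in simp)
  have "integrable (lebesgue_on \<Omega>) (\<lambda>x. (norm (f x))\<^sup>2)"
  proof (rule Bochner_Integration.integrable_bound[OF i])
    show "(\<lambda>x. (norm (f x))\<^sup>2) \<in> borel_measurable (lebesgue_on \<Omega>)" using m by measurable
    have "(norm (f x))\<^sup>2 \<le> indicator K x * C\<^sup>2" for x
      using C[of x] K(2)[of x] by (cases "x \<in> K") (auto intro: power_mono)
    then show "AE x in lebesgue_on \<Omega>. norm ((norm (f x))\<^sup>2) \<le> norm (indicator K x *\<^sub>R C\<^sup>2)"
      by (auto intro!: AE_I2)
  qed
  with m show ?thesis by (simp add: L2_def)
qed

lemma indicator_compact_L2:
  assumes ms: "\<Omega> \<in> sets lebesgue" and K: "compact K"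
  shows "(\<lambda>x. indicator K x :: real) \<in> L2 \<Omega>"
proof -
  have mK: "K \<in> lmeasurable" using K by (simp add: lmeasurable_compact)
  have m: "(\<lambda>x. indicator K x :: real) \<in> borel_measurable lebesgue"
    using mK by (intro borel_measurable_indicator) auto
  have "integrable lebesgue (indicat_real K)"
    using mK by (auto simp: fmeasurable_def)
  from integrable_mult_indicator[OF ms this]
  have "integrable (lebesgue_on \<Omega>) (indicat_real K)"
    by (rule integrable_restrict_space[THEN iffD2, rotated]) (use ms in simp)
  moreover have "(\<lambda>x. (norm (indicator K x::real))\<^sup>2) = indicat_real K"
    by (auto simp: indicator_def)
  ultimately show ?thesis using m by (auto simp: L2_def intro: measurable_restrict_space1)
qed


section \<open>Test functions as square integrable functions\<close>

lemma test_fun_props: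
  assumes "test_fun \<Omega> \<phi> D"
  shows "continuous_on UNIV \<phi>" "continuous_on UNIV D" "compact (closure {x. \<phi> x \<noteq> 0})"
    "\<And>x. x \<notin> closure {x. \<phi> x \<noteq> 0} \<Longrightarrow> \<phi> x = 0" "\<And>x. x \<notin> closure {x. \<phi> x \<noteq> 0} \<Longrightarrow> D x = 0"
proof -
  have d: "\<And>x. (\<phi> has_derivative (\<lambda>h. D x \<bullet> h)) (at x)"
    using assms by (simp add: test_fun_def)
  show "continuous_on UNIV \<phi>"
    using d by (meson continuous_at_imp_continuous_on has_derivative_continuous)
  show "continuous_on UNIV D" "compact (closure {x. \<phi> x \<noteq> 0})" using assms by (auto simp: test_fun_def)
  show z: "\<phi> x = 0" if "x \<notin> closure {x. \<phi> x \<noteq> 0}" for x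
    using that closure_subset[of "{x. \<phi> x \<noteq> 0}"] by blast
  show "D x = 0" if x: "x \<notin> closure {x. \<phi> x \<noteq> 0}" for x
  proof -
    have "((\<lambda>x. 0) has_derivative (\<lambda>h. D x \<bullet> h)) (at x)"
    proof (rule has_derivative_transform_within_open[OF d, of "- closure {x. \<phi> x \<noteq> 0}"])
      show "x \<in> - closure {x. \<phi> x \<noteq> 0}" using x by blast
    qed (use z in blast)+
    from fun_cong[OF has_derivative_unique[OF this has_derivative_const], of "D x"]
    show ?thesis by simp
  qed
qed

lemma test_fun_L2:
  assumes "\<Omega> \<in> sets lebesgue" "test_fun \<Omega> \<phi> D"
  shows "\<phi> \<in> L2 \<Omega>" "D \<in> L2 \<Omega>"
  using test_fun_props[OF assms(2)] continuous_compact_support_L2[OF assms(1)] by blast+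

lemma test_fun_lincomb:
  assumes "test_fun \<Omega> \<phi> D" "test_fun \<Omega> \<psi> E"
  shows "test_fun \<Omega> (\<lambda>x. a * \<phi> x + b * \<psi> x) (\<lambda>x. a *\<^sub>R D x + b *\<^sub>R E x)"
proof -
  let ?K = "closure {x. \<phi> x \<noteq> 0} \<union> closure {x. \<psi> x \<noteq> 0}"
  have K: "compact ?K" "?K \<subseteq> \<Omega>" using assms by (auto simp: test_fun_def)
  have cl: "closure {x. a * \<phi> x + b * \<psi> x \<noteq> 0} \<subseteq> ?K"
    unfolding closure_Un[symmetric] by (rule closure_mono) auto
  have "\<And>x. (\<phi> has_derivative (\<lambda>h. D x \<bullet> h)) (at x)" "\<And>x. (\<psi> has_derivative (\<lambda>h. E x \<bullet> h)) (at x)"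
    "continuous_on UNIV D" "continuous_on UNIV E"
    using assms by (auto simp: test_fun_def)
  note this(1,2)[derivative_intros] and this(3,4)[continuous_intros]
  show ?thesis unfolding test_fun_def
  proof (intro conjI allI)
    show "((\<lambda>x. a * \<phi> x + b * \<psi> x) has_derivative (\<lambda>h. (a *\<^sub>R D x + b *\<^sub>R E x) \<bullet> h)) (at x)" for x
      by (auto intro!: derivative_eq_intros simp: inner_add_left)
    show "continuous_on UNIV (\<lambda>x. a *\<^sub>R D x + b *\<^sub>R E x)" by (intro continuous_intros)
    show "compact (closure {x. a * \<phi> x + b * \<psi> x \<noteq> 0})"
      using compact_Int_closed[OF K(1) closed_closure, of "{x. a * \<phi> x + b * \<psi> x \<noteq> 0}"] cl
      by (simp add: inf.absorb2)
    show "closure {x. a * \<phi> x + b * \<psi> x \<noteq> 0} \<subseteq> \<Omega>" using cl K by blast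
  qed
qed


section \<open>Uniqueness and linearity of weak gradients\<close>

text \<open>
  Passing to the limit with test functions shows that the integral of \<open>g\<close> over every compact
  subset of \<open>\<Omega>\<close> is zero. Up to a null set, the set where a component of \<open>g\<close>
  is positive is a countable union of compact sets, and each of these is a null set because a positive
  function integrates to zero over it.
\<close>

lemma L2_eq_0_if_orthogonal_to_test_funs:
  fixes g :: "real^'n \<Rightarrow> 'b::euclidean_space"
  assumes \<Omega>: "open \<Omega>" and g: "g \<in> L2 \<Omega>"
    and orth: "\<And>\<phi> D. test_fun \<Omega> \<phi> D \<Longrightarrow> (LINT x|lebesgue_on \<Omega>. \<phi> x *\<^sub>R g x) = 0"
  shows "AE x in lebesgue_on \<Omega>. g x = 0"
proof -
  have ms[simp]: "\<Omega> \<in> sets lebesgue" using \<Omega> by (simp add: borel_open)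
  have gm[measurable]: "g \<in> borel_measurable (lebesgue_on \<Omega>)" using g by (simp add: L2_def)
  have Kc: "integrable (lebesgue_on \<Omega>) (\<lambda>x. indicator K x *\<^sub>R g x)" if "compact K" for K
  proof -
    have "(\<lambda>x. indicator K x :: real) \<in> L2 \<Omega>" by (rule indicator_compact_L2[OF ms that])
    from L2_bilinear_integrable[OF bounded_bilinear_scaleR this g] show ?thesis .
  qed
  have int0: "(LINT x|lebesgue_on \<Omega>. indicator K x *\<^sub>R g x) = 0" if K: "compact K" "K \<subseteq> \<Omega>" for K
  proof -
    obtain \<phi> D K' where \<phi>: "\<And>k::nat. test_fun \<Omega> (\<phi> k) (D k)"
      "\<And>k x. 0 \<le> \<phi> k x" "\<And>k x. \<phi> k x \<le> 1" "compact K'" "K' \<subseteq> \<Omega>" "\<And>k x. x \<notin> K' \<Longrightarrow> \<phi> k x = 0"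
      "\<And>x. (\<lambda>k. \<phi> k x) \<longlonglongrightarrow> indicator K x"
      by (rule compact_indicator_limit_of_test_funs[OF \<Omega> K]) blast
    have "(\<lambda>k. LINT x|lebesgue_on \<Omega>. \<phi> k x *\<^sub>R g x) \<longlonglongrightarrow> (LINT x|lebesgue_on \<Omega>. indicator K x *\<^sub>R g x)"
    proof (rule integral_dominated_convergence[where w="\<lambda>x. norm (indicator K' x *\<^sub>R g x)"])
      show "(\<lambda>x. indicator K x *\<^sub>R g x) \<in> borel_measurable (lebesgue_on \<Omega>)"
        using Kc[OF K(1)] by auto
      show "(\<lambda>x. \<phi> k x *\<^sub>R g x) \<in> borel_measurable (lebesgue_on \<Omega>)" for k
        using test_fun_L2(1)[OF ms \<phi>(1)] by (intro borel_measurable_scaleR gm) (auto simp: L2_def)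
      show "integrable (lebesgue_on \<Omega>) (\<lambda>x. norm (indicator K' x *\<^sub>R g x))"
        by (rule integrable_norm[OF Kc[OF \<phi>(4)]])
      show "AE x in lebesgue_on \<Omega>. (\<lambda>k. \<phi> k x *\<^sub>R g x) \<longlonglongrightarrow> indicator K x *\<^sub>R g x"
        by (intro AE_I2 tendsto_scaleR \<phi>(7) tendsto_const)
      have "norm (\<phi> k x *\<^sub>R g x) \<le> norm (indicator K' x *\<^sub>R g x)" for k x
        using \<phi>(2,3)[of k x] \<phi>(6)[of x k] by (cases "x \<in> K'") (auto simp: mult_left_le_one_le)
      then show "AE x in lebesgue_on \<Omega>. norm (\<phi> k x *\<^sub>R g x) \<le> norm (indicator K' x *\<^sub>R g x)" for k
        by (intro AE_I2)
    qed
    moreover have "(LINT x|lebesgue_on \<Omega>. \<phi> k x *\<^sub>R g x) = 0" for k by (rule orth[OF \<phi>(1)])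
    ultimately show ?thesis by (simp add: LIMSEQ_const_iff)
  qed
  \<comment> \<open>The factor \<open>c\<close> stands for a sign: the argument is used for a component of \<open>g\<close> and for its negative.\<close>
  have null: "{x \<in> \<Omega>. c * (g x \<bullet> i) > 0} \<in> null_sets lebesgue" (is "?P \<in> _") for c :: real and i
  proof (rule ccontr)
    assume nn: "?P \<notin> null_sets lebesgue"
    have "{x \<in> space (lebesgue_on \<Omega>). c * (g x \<bullet> i) > 0} \<in> sets (lebesgue_on \<Omega>)" by measurable
    then have mP: "?P \<in> sets lebesgue" by (auto simp: sets_restrict_space_iff)
    obtain C N where CN: "fsigma C" "N \<in> null_sets lebesgue" "C \<union> N = ?P" "disjnt C N"
      by (rule lebesgue_set_almost_fsigma[OF mP])
    obtain F :: "nat \<Rightarrow> _" where F: "range F \<subseteq> Collect compact" "C = \<Union>(range F)"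
      using fsigma_Union_compact[THEN iffD1, OF CN(1)] by metis
    have "F n \<in> null_sets lebesgue" for n
    proof -
      have Fn: "compact (F n)" "F n \<subseteq> ?P" using F CN(3) by auto
      have ind: "integrable (lebesgue_on \<Omega>) (\<lambda>x. indicator (F n) x *\<^sub>R g x)" by (rule Kc[OF Fn(1)])
      have i2: "integrable (lebesgue_on \<Omega>) (\<lambda>x. indicator (F n) x * (c * (g x \<bullet> i)))"
        using integrable_mult_right[OF integrable_inner_left[OF ind, of i], of c]
        by (simp add: mult.left_commute)
      have "(LINT x|lebesgue_on \<Omega>. indicator (F n) x * (c * (g x \<bullet> i)))
          = c * ((LINT x|lebesgue_on \<Omega>. indicator (F n) x *\<^sub>R g x) \<bullet> i)"
        using integral_inner_left[OF ind, of i]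
        unfolding mult.left_commute[of _ c] by simp
      also have "\<dots> = 0" using int0[OF Fn(1)] Fn(2) by (simp add: subset_iff)
      finally have "AE x in lebesgue_on \<Omega>. indicator (F n) x * (c * (g x \<bullet> i)) = 0"
      proof (subst (asm) integral_nonneg_eq_0_iff_AE[OF i2])
        have "0 \<le> indicator (F n) x * (c * (g x \<bullet> i))" for x
          using subsetD[OF Fn(2), of x] by (cases "x \<in> F n") auto
        then show "AE x in lebesgue_on \<Omega>. 0 \<le> indicator (F n) x * (c * (g x \<bullet> i))" by simp
      qed
      then have "AE x in lebesgue. x \<notin> F n"
        using Fn(2) by (auto simp: AE_restrict_space_iff elim!: eventually_mono)
      moreover have "F n \<in> sets lebesgue"
        using lmeasurable_compact[OF Fn(1)] by (simp add: fmeasurable_def)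
      ultimately show ?thesis by (simp add: AE_iff_null_sets)
    qed
    then have "C \<in> null_sets lebesgue" unfolding F(2) by blast
    with CN(2,3) nn show False using null_sets.Un[of C lebesgue N] by simp
  qed
  have "AE x in lebesgue_on \<Omega>. g x \<bullet> i = 0" for i
  proof -
    have "AE x in lebesgue. x \<notin> {x \<in> \<Omega>. 1 * (g x \<bullet> i) > 0} \<and> x \<notin> {x \<in> \<Omega>. -1 * (g x \<bullet> i) > 0}"
      using AE_not_in[OF null[of 1 i]] AE_not_in[OF null[of "-1" i]] by eventually_elim auto
    then have "AE x in lebesgue. x \<in> \<Omega> \<longrightarrow> g x \<bullet> i = 0"
      by (rule eventually_mono) (auto simp: not_less)
    then show ?thesis by (simp add: AE_restrict_space_iff)
  qed
  then have "AE x in lebesgue_on \<Omega>. \<forall>i\<in>Basis. g x \<bullet> i = 0"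
    by (intro AE_finite_allI) auto
  then show ?thesis by eventually_elim (auto intro: euclidean_eqI)
qed

lemma has_weak_gradient_unique:
  assumes "open \<Omega>" "w \<in> L2 \<Omega>" "g \<in> L2 \<Omega>" "k \<in> L2 \<Omega>"
    and "has_weak_gradient \<Omega> w g" "has_weak_gradient \<Omega> w k"
  shows "AE x in lebesgue_on \<Omega>. g x = k x"
proof -
  have ms: "\<Omega> \<in> sets lebesgue" using assms(1) by (simp add: borel_open)
  have "AE x in lebesgue_on \<Omega>. g x - k x = 0"
  proof (rule L2_eq_0_if_orthogonal_to_test_funs[OF assms(1) L2_diff[OF assms(3,4)]])
    fix \<phi> D assume t: "test_fun \<Omega> \<phi> D"
    note i = L2_bilinear_integrable[OF bounded_bilinear_scaleR test_fun_L2(1)[OF ms t]]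
    have "(LINT x|lebesgue_on \<Omega>. \<phi> x *\<^sub>R g x) = (LINT x|lebesgue_on \<Omega>. \<phi> x *\<^sub>R k x)"
      using assms(5)[unfolded has_weak_gradient_def, rule_format, OF t]
        assms(6)[unfolded has_weak_gradient_def, rule_format, OF t] by simp
    then show "(LINT x|lebesgue_on \<Omega>. \<phi> x *\<^sub>R (g x - k x)) = 0"
      using i[OF assms(3)] i[OF assms(4)] by (simp add: scaleR_diff_right)
  qed
  then show ?thesis by eventually_elim simp
qed

lemma has_weak_gradient_lincomb:
  assumes "open \<Omega>" "v \<in> L2 \<Omega>" "w \<in> L2 \<Omega>" "g \<in> L2 \<Omega>" "k \<in> L2 \<Omega>"
    and "has_weak_gradient \<Omega> v g" "has_weak_gradient \<Omega> w k"
  shows "has_weak_gradient \<Omega> (\<lambda>x. a * v x + b * w x) (\<lambda>x. a *\<^sub>R g x + b *\<^sub>R k x)"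
  unfolding has_weak_gradient_def
proof (intro allI impI)
  fix \<phi> D assume t: "test_fun \<Omega> \<phi> D"
  have ms: "\<Omega> \<in> sets lebesgue" using assms(1) by (simp add: borel_open)
  note i = L2_bilinear_integrable[OF bounded_bilinear_scaleR test_fun_L2(1)[OF ms t]]
  note j = L2_bilinear_integrable[OF bounded_bilinear_scaleR _ test_fun_L2(2)[OF ms t]]
  have "(LINT x|lebesgue_on \<Omega>. (a * v x + b * w x) *\<^sub>R D x)
      = (LINT x|lebesgue_on \<Omega>. a *\<^sub>R (v x *\<^sub>R D x) + b *\<^sub>R (w x *\<^sub>R D x))"
    by (simp add: scaleR_add_left)
  also have "\<dots> = a *\<^sub>R (LINT x|lebesgue_on \<Omega>. v x *\<^sub>R D x) + b *\<^sub>R (LINT x|lebesgue_on \<Omega>. w x *\<^sub>R D x)"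
    using j[OF assms(2)] j[OF assms(3)]
    by (subst Bochner_Integration.integral_add) (auto simp del: scaleR_scaleR)
  also have "\<dots> = - (a *\<^sub>R (LINT x|lebesgue_on \<Omega>. \<phi> x *\<^sub>R g x) + b *\<^sub>R (LINT x|lebesgue_on \<Omega>. \<phi> x *\<^sub>R k x))"
    using assms(6,7) t by (simp add: has_weak_gradient_def)
  also have "\<dots> = - (LINT x|lebesgue_on \<Omega>. a *\<^sub>R (\<phi> x *\<^sub>R g x) + b *\<^sub>R (\<phi> x *\<^sub>R k x))"
    using i[OF assms(4)] i[OF assms(5)]
    by (subst Bochner_Integration.integral_add) (auto simp del: scaleR_scaleR)
  also have "\<dots> = - (LINT x|lebesgue_on \<Omega>. \<phi> x *\<^sub>R (a *\<^sub>R g x + b *\<^sub>R k x))"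
    by (simp add: scaleR_add_right mult.commute)
  finally show "(LINT x|lebesgue_on \<Omega>. (a * v x + b * w x) *\<^sub>R D x) =
      - (LINT x|lebesgue_on \<Omega>. \<phi> x *\<^sub>R (a *\<^sub>R g x + b *\<^sub>R k x))" .
qed

lemma wgrad_H1:
  assumes "w \<in> H1 \<Omega>"
  shows "wgrad \<Omega> w \<in> L2 \<Omega>" "has_weak_gradient \<Omega> w (wgrad \<Omega> w)" "w \<in> L2 \<Omega>"
proof -
  have "\<exists>g. g \<in> L2 \<Omega> \<and> has_weak_gradient \<Omega> w g" using assms by (auto simp: H1_def)
  from someI_ex[OF this] show "wgrad \<Omega> w \<in> L2 \<Omega>" "has_weak_gradient \<Omega> w (wgrad \<Omega> w)"
    by (auto simp: wgrad_def)
  show "w \<in> L2 \<Omega>" using assms by (simp add: H1_def)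
qed

lemma H1_lincomb:
  assumes "open \<Omega>" "v \<in> H1 \<Omega>" "w \<in> H1 \<Omega>"
  shows "(\<lambda>x. a * v x + b * w x) \<in> H1 \<Omega>"
  using has_weak_gradient_lincomb[OF assms(1) wgrad_H1(3)[OF assms(2)] wgrad_H1(3)[OF assms(3)]
      wgrad_H1(1)[OF assms(2)] wgrad_H1(1)[OF assms(3)] wgrad_H1(2)[OF assms(2)] wgrad_H1(2)[OF assms(3)]]
    L2_lincomb[OF wgrad_H1(1)[OF assms(2)] wgrad_H1(1)[OF assms(3)]]
    L2_lincomb_real[OF wgrad_H1(3)[OF assms(2)] wgrad_H1(3)[OF assms(3)]]
  unfolding H1_def by blast

text \<open>
  The gradient is fixed by an arbitrary choice, so linearity holds only almost everywhere and depends on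
  uniqueness.
\<close>

lemma wgrad_lincomb:
  assumes "open \<Omega>" "v \<in> H1 \<Omega>" "w \<in> H1 \<Omega>"
  shows "AE x in lebesgue_on \<Omega>. wgrad \<Omega> (\<lambda>x. a * v x + b * w x) x = a *\<^sub>R wgrad \<Omega> v x + b *\<^sub>R wgrad \<Omega> w x"
proof -
  note v = wgrad_H1[OF assms(2)] and w = wgrad_H1[OF assms(3)] and vw = wgrad_H1[OF H1_lincomb[OF assms], of a b]
  show ?thesis
    by (rule has_weak_gradient_unique[OF assms(1) vw(3,1) L2_lincomb[OF v(1) w(1)] vw(2)
      has_weak_gradient_lincomb[OF assms(1) v(3) w(3) v(1) w(1) v(2) w(2)]])
qed

lemma L2_norm_lincomb_tendsto_0:
  fixes v w :: "nat \<Rightarrow> real^'n \<Rightarrow> 'b::euclidean_space"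
  assumes "\<And>k. v k \<in> L2 \<Omega>" "\<And>k. w k \<in> L2 \<Omega>"
    and "(\<lambda>k. L2_norm \<Omega> (v k)) \<longlonglongrightarrow> 0" "(\<lambda>k. L2_norm \<Omega> (w k)) \<longlonglongrightarrow> 0"
  shows "(\<lambda>k. L2_norm \<Omega> (\<lambda>x. a *\<^sub>R v k x + b *\<^sub>R w k x)) \<longlonglongrightarrow> 0"
proof -
  have sq: "(L2_norm \<Omega> z)\<^sup>2 = (LINT x|lebesgue_on \<Omega>. (norm (z x))\<^sup>2)" for z :: "real^'n \<Rightarrow> 'b"
    by (simp add: L2_norm_def integral_nonneg)
  have le: "(L2_norm \<Omega> (\<lambda>x. a *\<^sub>R v k x + b *\<^sub>R w k x))\<^sup>2
      \<le> 2 * a\<^sup>2 * (L2_norm \<Omega> (v k))\<^sup>2 + 2 * b\<^sup>2 * (L2_norm \<Omega> (w k))\<^sup>2" for k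
  proof -
    have iv: "integrable (lebesgue_on \<Omega>) (\<lambda>x. (norm (v k x))\<^sup>2)"
     and iw: "integrable (lebesgue_on \<Omega>) (\<lambda>x. (norm (w k x))\<^sup>2)"
      using assms(1,2)[of k] by (auto intro: integrable_L2_norm_sq)
    have "(LINT x|lebesgue_on \<Omega>. (norm (a *\<^sub>R v k x + b *\<^sub>R w k x))\<^sup>2)
        \<le> (LINT x|lebesgue_on \<Omega>. 2 * a\<^sup>2 * (norm (v k x))\<^sup>2 + 2 * b\<^sup>2 * (norm (w k x))\<^sup>2)"
      using iv iw norm_sq_lincomb_le
      by (intro integral_mono integrable_L2_norm_sq L2_lincomb assms) auto
    also have "\<dots> = 2 * a\<^sup>2 * (LINT x|lebesgue_on \<Omega>. (norm (v k x))\<^sup>2) + 2 * b\<^sup>2 * (LINT x|lebesgue_on \<Omega>. (norm (w k x))\<^sup>2)"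
      using iv iw by simp
    finally show ?thesis by (simp only: sq)
  qed
  have "(\<lambda>k. 2 * a\<^sup>2 * (L2_norm \<Omega> (v k))\<^sup>2 + 2 * b\<^sup>2 * (L2_norm \<Omega> (w k))\<^sup>2) \<longlonglongrightarrow> 2 * a\<^sup>2 * 0\<^sup>2 + 2 * b\<^sup>2 * 0\<^sup>2"
    by (intro tendsto_intros assms)
  then have lim: "(\<lambda>k. 2 * a\<^sup>2 * (L2_norm \<Omega> (v k))\<^sup>2 + 2 * b\<^sup>2 * (L2_norm \<Omega> (w k))\<^sup>2) \<longlonglongrightarrow> 0"
    by simp
  have "(\<lambda>k. (L2_norm \<Omega> (\<lambda>x. a *\<^sub>R v k x + b *\<^sub>R w k x))\<^sup>2) \<longlonglongrightarrow> 0"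
    by (rule tendsto_sandwich[OF _ _ tendsto_const lim]) (simp_all add: le)
  from tendsto_real_sqrt[OF this] show ?thesis
    by (simp add: L2_norm_def integral_nonneg)
qed

lemma L2_norm_cong_AE:
  assumes "v \<in> L2 \<Omega>" "w \<in> L2 \<Omega>" "AE x in lebesgue_on \<Omega>. v x = w x"
  shows "L2_norm \<Omega> v = L2_norm \<Omega> w"
proof -
  have [measurable]: "v \<in> borel_measurable (lebesgue_on \<Omega>)" "w \<in> borel_measurable (lebesgue_on \<Omega>)"
    using assms by (auto simp: L2_def)
  have "(LINT x|lebesgue_on \<Omega>. (norm (v x))\<^sup>2) = (LINT x|lebesgue_on \<Omega>. (norm (w x))\<^sup>2)"
    using assms(3) by (intro integral_cong_AE) auto
  then show ?thesis by (simp add: L2_norm_def)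
qed


section \<open>The linear structure of \<open>H01\<close> and of the weak operator\<close>

lemma H01_subset_H1: "w \<in> H01 \<Omega> \<Longrightarrow> w \<in> H1 \<Omega>"
  by (simp add: H01_def)

lemma H01_L2: "w \<in> H01 \<Omega> \<Longrightarrow> w \<in> L2 \<Omega>"
  by (simp add: H01_def H1_def)

lemma H01_lincomb:
  assumes \<Omega>: "open \<Omega>" and v: "v \<in> H01 \<Omega>" and w: "w \<in> H01 \<Omega>"
  shows "(\<lambda>x. a * v x + b * w x) \<in> H01 \<Omega>"
proof -
  have ms: "\<Omega> \<in> sets lebesgue" using \<Omega> by (simp add: borel_open)
  note v1 = H01_subset_H1[OF v] and w1 = H01_subset_H1[OF w]
  obtain \<phi> D where \<phi>: "\<And>k::nat. test_fun \<Omega> (\<phi> k) (D k)"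
    "(\<lambda>k. L2_norm \<Omega> (\<lambda>x. v x - \<phi> k x)) \<longlonglongrightarrow> 0" "(\<lambda>k. L2_norm \<Omega> (\<lambda>x. wgrad \<Omega> v x - D k x)) \<longlonglongrightarrow> 0"
    using v by (auto simp: H01_def)
  obtain \<psi> E where \<psi>: "\<And>k::nat. test_fun \<Omega> (\<psi> k) (E k)"
    "(\<lambda>k. L2_norm \<Omega> (\<lambda>x. w x - \<psi> k x)) \<longlonglongrightarrow> 0" "(\<lambda>k. L2_norm \<Omega> (\<lambda>x. wgrad \<Omega> w x - E k x)) \<longlonglongrightarrow> 0"
    using w by (auto simp: H01_def)
  note tL = test_fun_L2[OF ms \<phi>(1)] test_fun_L2[OF ms \<psi>(1)]
  let ?z = "\<lambda>x. a * v x + b * w x"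
  have z1: "?z \<in> H1 \<Omega>" by (rule H1_lincomb[OF \<Omega> v1 w1])
  have "(\<lambda>k. L2_norm \<Omega> (\<lambda>x. a *\<^sub>R (v x - \<phi> k x) + b *\<^sub>R (w x - \<psi> k x))) \<longlonglongrightarrow> 0"
    using wgrad_H1(3)[OF v1] wgrad_H1(3)[OF w1] tL
    by (intro L2_norm_lincomb_tendsto_0 L2_diff \<phi> \<psi>) auto
  then have 1: "(\<lambda>k. L2_norm \<Omega> (\<lambda>x. ?z x - (a * \<phi> k x + b * \<psi> k x))) \<longlonglongrightarrow> 0"
    by (simp add: algebra_simps)
  have "(\<lambda>k. L2_norm \<Omega> (\<lambda>x. a *\<^sub>R (wgrad \<Omega> v x - D k x) + b *\<^sub>R (wgrad \<Omega> w x - E k x))) \<longlonglongrightarrow> 0"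
    using wgrad_H1(1)[OF v1] wgrad_H1(1)[OF w1] tL
    by (intro L2_norm_lincomb_tendsto_0 L2_diff \<phi> \<psi>) auto
  moreover have "L2_norm \<Omega> (\<lambda>x. a *\<^sub>R (wgrad \<Omega> v x - D k x) + b *\<^sub>R (wgrad \<Omega> w x - E k x))
     = L2_norm \<Omega> (\<lambda>x. wgrad \<Omega> ?z x - (a *\<^sub>R D k x + b *\<^sub>R E k x))" for k
    using wgrad_lincomb[OF \<Omega> v1 w1, of a b] wgrad_H1(1)[OF v1] wgrad_H1(1)[OF w1] wgrad_H1(1)[OF z1] tL[of k]
    by (intro L2_norm_cong_AE L2_lincomb L2_diff)
       (auto elim!: eventually_mono simp: algebra_simps)
  ultimately have 2: "(\<lambda>k. L2_norm \<Omega> (\<lambda>x. wgrad \<Omega> ?z x - (a *\<^sub>R D k x + b *\<^sub>R E k x))) \<longlonglongrightarrow> 0"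
    by simp
  from z1 1 2 test_fun_lincomb[OF \<phi>(1) \<psi>(1)] show ?thesis
    unfolding H01_def
    by (auto intro!: exI[of _ "\<lambda>k x. a * \<phi> k x + b * \<psi> k x"] exI[of _ "\<lambda>k x. a *\<^sub>R D k x + b *\<^sub>R E k x"])
qed

lemma H01_add: "open \<Omega> \<Longrightarrow> v \<in> H01 \<Omega> \<Longrightarrow> w \<in> H01 \<Omega> \<Longrightarrow> (\<lambda>x. v x + w x) \<in> H01 \<Omega>"
  using H01_lincomb[of \<Omega> v w 1 1] by simp

lemma H01_diff: "open \<Omega> \<Longrightarrow> v \<in> H01 \<Omega> \<Longrightarrow> w \<in> H01 \<Omega> \<Longrightarrow> (\<lambda>x. v x - w x) \<in> H01 \<Omega>"
  using H01_lincomb[of \<Omega> v w 1 "-1"] by simp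

lemma H01_cmult: "open \<Omega> \<Longrightarrow> v \<in> H01 \<Omega> \<Longrightarrow> (\<lambda>x. c * v x) \<in> H01 \<Omega>"
  using H01_lincomb[of \<Omega> v v c 0] by simp

lemma H01_sum:
  assumes "open \<Omega>" "finite J" "J \<noteq> {}" "\<And>j. j \<in> J \<Longrightarrow> v j \<in> H01 \<Omega>"
  shows "(\<lambda>x. \<Sum>j\<in>J. c j * v j x) \<in> H01 \<Omega>"
  using assms(2,3,4)
proof (induction J rule: finite_ne_induct)
  case (singleton j) then show ?case using H01_cmult[OF assms(1)] by simp
next
  case (insert j F)
  then show ?case using H01_add[OF assms(1) H01_cmult[OF assms(1)], of "v j" _ "c j"] by simp
qed

lemma weak_op_lincomb:
  assumes \<Omega>: "open \<Omega>" and L: "elliptic \<Omega> L" and v: "v \<in> H1 \<Omega>" and w: "w \<in> H1 \<Omega>" and z: "z \<in> H1 \<Omega>"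
  shows "weak_op \<Omega> L (\<lambda>x. a * v x + b * w x) z = a * weak_op \<Omega> L v z + b * weak_op \<Omega> L w z"
proof -
  have bb: "bounded_bilinear ((*v) :: real^'n^'n \<Rightarrow> _)"
    unfolding bilinear_conv_bounded_bilinear[symmetric] bilinear_def
    by (simp add: matrix_vector_mul_linear)
       (auto intro!: linearI simp: matrix_vector_mult_add_rdistrib scaleR_matrix_vector_assoc)
  let ?F = "\<lambda>v g x. (coeff_A L x *v g x + v x *\<^sub>R coeff_b L x) \<bullet> wgrad \<Omega> z x
       + (coeff_c L x \<bullet> g x) * z x + coeff_d L x * v x * z x"
  have c: "bounded_coeff \<Omega> (coeff_A L)" "bounded_coeff \<Omega> (coeff_b L)"
    "bounded_coeff \<Omega> (coeff_c L)" "bounded_coeff \<Omega> (coeff_d L)"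
    using L by (auto simp: elliptic_def)
  have F: "integrable (lebesgue_on \<Omega>) (?F v g)" if "v \<in> L2 \<Omega>" "g \<in> L2 \<Omega>" for v g
  proof -
    have "(\<lambda>x. coeff_A L x *v g x) \<in> L2 \<Omega>" by (rule L2_bounded_coeff[OF bb c(1) that(2)])
    moreover have "(\<lambda>x. v x *\<^sub>R coeff_b L x) \<in> L2 \<Omega>"
      using L2_bounded_coeff[OF bounded_bilinear.flip[OF bounded_bilinear_scaleR] c(2) that(1)] .
    ultimately have 1: "integrable (lebesgue_on \<Omega>) (\<lambda>x. (coeff_A L x *v g x + v x *\<^sub>R coeff_b L x) \<bullet> wgrad \<Omega> z x)"
      by (intro L2_bilinear_integrable[OF bounded_bilinear_inner] L2_add wgrad_H1 z)
    have 2: "integrable (lebesgue_on \<Omega>) (\<lambda>x. (coeff_c L x \<bullet> g x) * z x)"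
      by (intro L2_mult_integrable L2_bounded_coeff[OF bounded_bilinear_inner c(3) that(2)] wgrad_H1(3)[OF z])
    have 3: "integrable (lebesgue_on \<Omega>) (\<lambda>x. coeff_d L x * v x * z x)"
      by (intro L2_mult_integrable L2_bounded_coeff[OF bounded_bilinear_mult c(4) that(1)] wgrad_H1(3)[OF z])
    show ?thesis by (intro Bochner_Integration.integrable_add 1 2 3)
  qed
  note v' = wgrad_H1[OF v] and w' = wgrad_H1[OF w]
  note vw = wgrad_H1[OF H1_lincomb[OF \<Omega> v w], of a b]
  have "weak_op \<Omega> L (\<lambda>x. a * v x + b * w x) z
      = (LINT x|lebesgue_on \<Omega>. a * ?F v (wgrad \<Omega> v) x + b * ?F w (wgrad \<Omega> w) x)"
    unfolding weak_op_def
  proof (rule integral_cong_AE)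
    show "AE x in lebesgue_on \<Omega>. ?F (\<lambda>x. a * v x + b * w x) (wgrad \<Omega> (\<lambda>x. a * v x + b * w x)) x
       = a * ?F v (wgrad \<Omega> v) x + b * ?F w (wgrad \<Omega> w) x"
      using wgrad_lincomb[OF \<Omega> v w, of a b]
      by eventually_elim (simp add: algebra_simps inner_add_left inner_add_right
        matrix_vector_right_distrib matrix_vector_mult_scaleR)
  qed (use F[OF vw(3,1)] F[OF v'(3,1)] F[OF w'(3,1)] in auto)
  also have "\<dots> = a * weak_op \<Omega> L v z + b * weak_op \<Omega> L w z"
    using F[OF v'(3,1)] F[OF w'(3,1)] unfolding weak_op_def by simp
  finally show ?thesis .
qed

lemma weak_op_diff:
  assumes "open \<Omega>" "elliptic \<Omega> L" "v \<in> H1 \<Omega>" "w \<in> H1 \<Omega>" "z \<in> H1 \<Omega>"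
  shows "weak_op \<Omega> L (\<lambda>x. v x - w x) z = weak_op \<Omega> L v z - weak_op \<Omega> L w z"
  using weak_op_lincomb[OF assms, of 1 "- 1"] by simp


section \<open>Piecewise linear interpolation on a mesh\<close>

lemma mesh_mono:
  assumes "mesh T M t" "i \<le> j" "j \<le> M"
  shows "t i \<le> t j"
  using assms(2,3)
proof (induction j rule: dec_induct)
  case (step n)
  moreover from assms(1) step have "t n < t (Suc n)" by (simp add: mesh_def)
  ultimately show ?case by simp
qed simp

lemma mesh_interval:
  assumes "mesh T M t" "j \<in> {1..M}"
  shows "0 \<le> t (j - 1)" "t (j - 1) < t j" "t j \<le> T" "0 < step t j"
proof -
  have "t 0 \<le> t (j - 1)" "t j \<le> t M"
    using assms by (auto intro!: mesh_mono[OF assms(1)])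
  moreover have "t (j - 1) < t j"
  proof -
    obtain k where "j = Suc k" "k < M" using assms(2) by (cases j) auto
    then show ?thesis using assms(1) by (simp add: mesh_def)
  qed
  ultimately show "0 \<le> t (j - 1)" "t (j - 1) < t j" "t j \<le> T" "0 < step t j"
    using assms by (auto simp: mesh_def step_def)
qed

lemma mesh_intervals_disjoint:
  assumes "mesh T M t" "i \<in> {1..M}" "j \<in> {1..M}" "s \<in> {t (i - 1)<..t i}" "s \<in> {t (j - 1)<..t j}"
  shows "i = j"
proof (rule linorder_cases[of i j])
  assume "i < j"
  then have "t i \<le> t (j - 1)" using assms by (intro mesh_mono[OF assms(1)]) auto
  then show ?thesis using assms by auto
next
  assume "j < i"
  then have "t j \<le> t (i - 1)" using assms by (intro mesh_mono[OF assms(1)]) auto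
  then show ?thesis using assms by auto
qed

lemma indicator_mesh_interval:
  assumes "mesh T M t" "i \<in> {1..M}" "j \<in> {1..M}" "s \<in> {t (j - 1)<..t j}"
  shows "indicator {t (i - 1)<..t i} s = of_bool (i = j)"
proof (cases "i = j")
  case True
  then show ?thesis using assms(4) by simp
next
  case False
  then have "s \<notin> {t (i - 1)<..t i}"
    using mesh_intervals_disjoint[OF assms(1-3) _ assms(4)] by blast
  then show ?thesis using False by simp
qed

lemma mesh_intervals_cover:
  assumes "mesh T M t" "0 < s" "s \<le> T"
  obtains j where "j \<in> {1..M}" "s \<in> {t (j - 1)<..t j}"
proof -
  define j where "j = (LEAST j. s \<le> t j)"
  have M: "s \<le> t M" using assms by (simp add: mesh_def)
  have j: "s \<le> t j" "j \<le> M" unfolding j_def using M by (auto intro: LeastI Least_le)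
  have "j \<noteq> 0" using j(1) assms by (metis mesh_def not_le)
  then have "\<not> s \<le> t (j - 1)" using not_less_Least[of "j - 1" "\<lambda>j. s \<le> t j"] by (simp add: j_def)
  with j \<open>j \<noteq> 0\<close> show ?thesis by (intro that[of j]) auto
qed

text \<open>
  The index of the mesh interval that contains \<open>s\<close>, and 0 outside of all of them. In the form of
  a sum of multiples of indicators it is a simple function.
\<close>

definition mesh_index :: "(nat \<Rightarrow> real) \<Rightarrow> nat \<Rightarrow> real \<Rightarrow> nat" where
  "mesh_index t M s = (\<Sum>j=1..M. j * indicator {t (j - 1)<..t j} s)"

text \<open>
  The coefficient of the \<open>j\<close>-th slope is the length of the part of the \<open>j\<close>-th mesh
  interval that lies before \<open>s\<close>, so that \<open>pl_interp\<close> is visibly the integral of its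
  piecewise constant derivative.
\<close>

definition pl_interp :: "(nat \<Rightarrow> real) \<Rightarrow> nat \<Rightarrow> (nat \<Rightarrow> 'a \<Rightarrow> real) \<Rightarrow> real \<Rightarrow> 'a \<Rightarrow> real" where
  "pl_interp t M U s = (\<lambda>x. U 0 x + (\<Sum>j=1..M. max 0 (min s (t j) - t (j - 1)) * delta_t t U j x))"

lemma mesh_index_eq:
  assumes "mesh T M t" "j \<in> {1..M}" "s \<in> {t (j - 1)<..t j}"
  shows "mesh_index t M s = j"
proof -
  have "mesh_index t M s = (\<Sum>i=1..M. if i = j then j else 0)"
    unfolding mesh_index_def
    by (intro sum.cong refl) (simp add: indicator_mesh_interval[OF assms(1) _ assms(2,3)] del: One_nat_def)
  also have "\<dots> = j" using assms(2) by simp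
  finally show ?thesis .
qed

text \<open>
  Outside the mesh intervals the index is 0, and \<open>delta_t\<close> vanishes at this index because
  \<open>0 - 1 = 0\<close> on natural numbers.
\<close>

lemma delta_t_mesh_index:
  assumes "mesh T M t"
  shows "delta_t t U (mesh_index t M s) x = (\<Sum>j=1..M. indicator {t (j - 1)<..t j} s * delta_t t U j x)"
proof (cases "\<exists>j\<in>{1..M}. s \<in> {t (j - 1)<..t j}")
  case True
  then obtain j where j: "j \<in> {1..M}" "s \<in> {t (j - 1)<..t j}" by blast
  have "(\<Sum>i=1..M. indicator {t (i - 1)<..t i} s * delta_t t U i x) = (\<Sum>i=1..M. if i = j then delta_t t U j x else 0)"
    by (intro sum.cong refl) (simp add: indicator_mesh_interval[OF assms(1) _ j] del: One_nat_def)
  also have "\<dots> = delta_t t U j x" using j(1) by simp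
  finally show ?thesis using mesh_index_eq[OF assms j] by simp
next
  case False
  then have z: "s \<notin> {t (j - 1)<..t j}" if "j \<in> {1..M}" for j
    using that by blast
  have "mesh_index t M s = 0"
    unfolding mesh_index_def by (intro sum.neutral ballI) (simp only: indicator_simps(2)[OF z] mult_zero_right)
  moreover have "(\<Sum>j=1..M. indicator {t (j - 1)<..t j} s * delta_t t U j x) = 0"
    by (intro sum.neutral ballI) (simp only: indicator_simps(2)[OF z] mult_zero_left)
  ultimately show ?thesis by (simp add: delta_t_def)
qed

lemma sum_step_delta_t:
  assumes "mesh T M t" "k \<le> M"
  shows "(\<Sum>i=1..k. step t i * delta_t t U i x) = U k x - U 0 x"
  using assms(2)
proof (induction k)
  case (Suc k)
  have "step t (Suc k) > 0" using mesh_interval(4)[OF assms(1), of "Suc k"] Suc.prems by simp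
  then show ?case using Suc by (simp add: delta_t_def)
qed simp

lemma pl_interp_eq:
  assumes "mesh T M t" "j \<in> {1..M}" "s \<in> {t (j - 1)<..t j}"
  shows "pl_interp t M U s x = U j x - (t j - s) * delta_t t U j x"
proof -
  let ?c = "\<lambda>i. max 0 (min s (t i) - t (i - 1))"
  have "{1..M} = {1..j} \<union> {Suc j..M}" using assms(2) by auto
  then have "(\<Sum>i=1..M. ?c i * delta_t t U i x)
      = (\<Sum>i=1..j. ?c i * delta_t t U i x) + (\<Sum>i=Suc j..M. ?c i * delta_t t U i x)"
    by (simp add: sum.union_disjoint)
  also have "(\<Sum>i=Suc j..M. ?c i * delta_t t U i x) = 0"
  proof (intro sum.neutral ballI)
    fix i assume "i \<in> {Suc j..M}"
    then have "t j \<le> t (i - 1)" by (intro mesh_mono[OF assms(1)]) auto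
    then show "?c i * delta_t t U i x = 0" using assms(3) by auto
  qed
  also have "(\<Sum>i=1..j. ?c i * delta_t t U i x)
      = (\<Sum>i=1..j. step t i * delta_t t U i x - (if i = j then (t j - s) * delta_t t U j x else 0))"
  proof (intro sum.cong refl)
    fix i assume i: "i \<in> {1..j}"
    show "?c i * delta_t t U i x = step t i * delta_t t U i x - (if i = j then (t j - s) * delta_t t U j x else 0)"
    proof (cases "i = j")
      case True
      then show ?thesis using assms(3) by (simp add: step_def algebra_simps)
    next
      case False
      then have "t i \<le> t (j - 1)" using i assms(2) by (intro mesh_mono[OF assms(1)]) auto
      then have "t i < s" using assms(3) by auto
      moreover have "t (i - 1) < t i" using mesh_interval(2)[OF assms(1), of i] i assms(2) by auto
      ultimately show ?thesis using False by (simp add: step_def)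
    qed
  qed
  also have "\<dots> = U j x - U 0 x - (t j - s) * delta_t t U j x"
    using sum_step_delta_t[OF assms(1), of j U x] assms(2) by (simp add: sum_subtractf)
  finally show ?thesis by (simp add: pl_interp_def)
qed

lemma pl_interp_0:
  assumes "mesh T M t"
  shows "pl_interp t M U 0 = U 0"
proof -
  have "max 0 (min 0 (t j) - t (j - 1)) = 0" if "j \<in> {1..M}" for j
    using mesh_interval(1)[OF assms that] by auto
  then show ?thesis by (simp add: pl_interp_def)
qed

lemma pl_interp_T:
  assumes "mesh T M t" "T > 0"
  shows "pl_interp t M U T = U M"
proof
  fix x
  have M: "M \<in> {1..M}" "t M = T" using assms by (auto simp: mesh_def Suc_le_eq intro!: gr0I)
  from pl_interp_eq[OF assms(1) M(1), of T U x] M mesh_interval(2)[OF assms(1) M(1)]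
  show "pl_interp t M U T x = U M x" by simp
qed


section \<open>Subtracting the interpolant from a function in \<open>W\<^sup>1\<^sup>,\<^sup>1\<close>\<close>

text \<open>
  Evaluating the integral of a simple function pointwise in space reduces its linearity to that of the real
  Lebesgue integral, which replaces the refinement of two simple functions to a common partition.
\<close>

lemma simple_integral_fun_eq:
  assumes "S \<in> lmeasurable" "simple_function (lebesgue_on S) s"
  shows "integrable (lebesgue_on S) (\<lambda>r. s r x)" (is ?I)
    and "simple_integral_fun S s x = (LINT r|lebesgue_on S. s r x)"
proof -
  have Sm: "S \<in> sets lebesgue" using assms(1) by auto
  have fin: "finite (s ` S)" using simple_functionD(1)[OF assms(2)] by simp
  have A: "{r\<in>S. s r = z} \<in> sets lebesgue" for z
  proof -
    have "s -` {z} \<inter> space (lebesgue_on S) \<in> sets (lebesgue_on S)"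
      by (rule simple_functionD(2)[OF assms(2)])
    moreover have "s -` {z} \<inter> space (lebesgue_on S) = {r\<in>S. s r = z}" by auto
    ultimately show ?thesis using Sm by (auto simp: sets_restrict_space_iff)
  qed
  interpret finite_measure "lebesgue_on S"
    using assms(1) by (auto intro!: finite_measureI simp: emeasure_restrict_space fmeasurable_def less_top)
  have eq: "s r x = (\<Sum>z\<in>s ` S. z x * indicator {r\<in>S. s r = z} r)" if "r \<in> S" for r
  proof -
    have "(\<Sum>z\<in>s ` S. z x * indicator {r\<in>S. s r = z} r) = (\<Sum>z\<in>s ` S. if z = s r then s r x else 0)"
      using that by (intro sum.cong) (auto simp: indicator_def)
    also have "\<dots> = s r x" using that fin by simp
    finally show ?thesis by simp
  qed
  have A': "{r\<in>S. s r = z} \<in> sets (lebesgue_on S)" for z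
    using A Sm by (auto simp: sets_restrict_space_iff)
  have i: "integrable (lebesgue_on S) (\<lambda>r. z x * indicator {r\<in>S. s r = z} r)" for z
    using A'[of z] by (intro integrable_mult_right) (simp add: emeasure_eq_measure)
  have "integrable (lebesgue_on S) (\<lambda>r. \<Sum>z\<in>s ` S. z x * indicator {r\<in>S. s r = z} r)"
    by (intro Bochner_Integration.integrable_sum i)
  then show ?I
    by (rule Bochner_Integration.integrable_cong[THEN iffD1, OF refl, rotated]) (simp add: eq)
  have "(LINT r|lebesgue_on S. s r x) = (LINT r|lebesgue_on S. (\<Sum>z\<in>s ` S. z x * indicator {r\<in>S. s r = z} r))"
    by (intro Bochner_Integration.integral_cong refl) (simp add: eq)
  also have "\<dots> = (\<Sum>z\<in>s ` S. LINT r|lebesgue_on S. z x * indicator {r\<in>S. s r = z} r)"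
    by (intro Bochner_Integration.integral_sum i)
  also have "\<dots> = (\<Sum>z\<in>s ` S. measure lebesgue {r\<in>S. s r = z} * z x)"
    using A' Sm by (intro sum.cong refl) (simp add: measure_restrict_space Int_absorb2 subset_iff Collect_conj_eq)
  finally show "simple_integral_fun S s x = (LINT r|lebesgue_on S. s r x)"
    by (simp add: simple_integral_fun_def)
qed

text \<open>
  If \<open>s k\<close> approximates \<open>g\<close> then \<open>s k - c\<close> approximates \<open>g -
  c\<close> with literally the same differences, so all three convergence statements carry over unchanged.
\<close>

lemma has_H01_integral_diff_simple:
  assumes \<Omega>: "open \<Omega>" and S: "S \<in> lmeasurable" and g: "has_H01_integral \<Omega> S g y"
    and c: "simple_function (lebesgue_on S) c" "c ` S \<subseteq> H01 \<Omega>"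
  shows "has_H01_integral \<Omega> S (\<lambda>r x. g r x - c r x) (\<lambda>x. y x - (LINT r|lebesgue_on S. c r x))"
proof -
  obtain s where s: "\<And>k::nat. simple_function (lebesgue_on S) (s k)" "\<And>k. s k ` S \<subseteq> H01 \<Omega>"
      "AE r in lebesgue_on S. (\<lambda>k. H1_norm \<Omega> (\<lambda>x. s k r x - g r x)) \<longlonglongrightarrow> 0"
      "(\<lambda>k. \<integral>\<^sup>+r. ennreal (H1_norm \<Omega> (\<lambda>x. s k r x - g r x)) \<partial>lebesgue_on S) \<longlonglongrightarrow> 0"
      "(\<lambda>k. H1_norm \<Omega> (\<lambda>x. simple_integral_fun S (s k) x - y x)) \<longlonglongrightarrow> 0"
    and y: "y \<in> H01 \<Omega>" and gH: "AE r in lebesgue_on S. g r \<in> H01 \<Omega>"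
    using g unfolding has_H01_integral_def by blast
  have fin: "finite (c ` S)" using simple_functionD(1)[OF c(1)] by simp
  have cH: "simple_integral_fun S c \<in> H01 \<Omega>"
  proof (cases "c ` S = {}")
    case True
    then show ?thesis using H01_cmult[OF \<Omega> y, of 0] by (simp add: simple_integral_fun_def)
  next
    case False
    show ?thesis unfolding simple_integral_fun_def
      by (rule H01_sum[OF \<Omega> fin False, of "\<lambda>z. z"]) (rule subsetD[OF c(2)])
  qed
  have eq: "simple_integral_fun S c = (\<lambda>x. LINT r|lebesgue_on S. c r x)"
    by (rule ext) (rule simple_integral_fun_eq(2)[OF S c(1)])
  have yH: "(\<lambda>x. y x - (LINT r|lebesgue_on S. c r x)) \<in> H01 \<Omega>"
    using H01_diff[OF \<Omega> y cH] unfolding eq .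
  let ?s = "\<lambda>k r x. s k r x - c r x"
  have ss: "simple_function (lebesgue_on S) (?s k)" for k
    using simple_function_compose2[OF s(1) c(1), of "\<lambda>a b x. a x - b x"] by simp
  have int: "simple_integral_fun S (?s k) x - (y x - (LINT r|lebesgue_on S. c r x)) = simple_integral_fun S (s k) x - y x" for k x
    unfolding simple_integral_fun_eq(2)[OF S ss] simple_integral_fun_eq(2)[OF S s(1)]
    by (subst Bochner_Integration.integral_diff)
       (simp_all add: simple_integral_fun_eq(1)[OF S s(1)] simple_integral_fun_eq(1)[OF S c(1)])
  have "AE r in lebesgue_on S. r \<in> S" by (rule AE_I2) simp
  with gH have gcH: "AE r in lebesgue_on S. (\<lambda>x. g r x - c r x) \<in> H01 \<Omega>"
  proof eventually_elim
    case (elim r)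
    then have "c r \<in> H01 \<Omega>" using c(2) by auto
    with elim show ?case by (intro H01_diff[OF \<Omega>])
  qed
  have sH: "?s k ` S \<subseteq> H01 \<Omega>" for k
    using s(2) c(2) by (auto intro!: H01_diff[OF \<Omega>])
  show ?thesis unfolding has_H01_integral_def
  proof (intro conjI yH gcH exI[of _ ?s] allI ss sH)
    have d: "(\<lambda>x. ?s k r x - (g r x - c r x)) = (\<lambda>x. s k r x - g r x)" for k r by simp
    show "AE r in lebesgue_on S. (\<lambda>k. H1_norm \<Omega> (\<lambda>x. ?s k r x - (g r x - c r x))) \<longlonglongrightarrow> 0"
      unfolding d by (rule s(3))
    show "(\<lambda>k. \<integral>\<^sup>+r. ennreal (H1_norm \<Omega> (\<lambda>x. ?s k r x - (g r x - c r x))) \<partial>lebesgue_on S) \<longlonglongrightarrow> 0"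
      unfolding d by (rule s(4))
    show "(\<lambda>k. H1_norm \<Omega> (\<lambda>x. simple_integral_fun S (?s k) x - (y x - (LINT r|lebesgue_on S. c r x)))) \<longlonglongrightarrow> 0"
      unfolding int by (rule s(5))
  qed
qed

lemma simple_function_mesh_index:
  assumes "S \<in> sets lebesgue"
  shows "simple_function (lebesgue_on S) (mesh_index t M)"
proof -
  have "simple_function (lebesgue_on S) (\<lambda>s. j * indicator {t (j - 1)<..t j} s)" for j
  proof -
    have "simple_function lebesgue (indicator {t (j - 1)<..t j} :: real \<Rightarrow> nat)"
      by (intro simple_function_indicator) auto
    from simple_function_compose1[OF this, of "\<lambda>n. j * n"]
    have "simple_function lebesgue (\<lambda>s. j * indicator {t (j - 1)<..t j} s)" .
    then show ?thesis
      unfolding simple_function_eq_measurable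
      using finite_subset[OF image_mono[of "space (lebesgue_on S)" "space lebesgue"]]
      by (auto intro: measurable_restrict_space1)
  qed
  then show ?thesis unfolding mesh_index_def[abs_def] by (intro simple_function_sum)
qed

text \<open>
  This makes the error an admissible argument of the Green's function representation. On \<open>[0, r]\<close>
  the integral of the slope of \<open>pl_interp\<close> is computed pointwise in space as a sum over the mesh
  intervals.
\<close>

lemma W11_H01_minus_pl_interp:
  assumes \<Omega>: "open \<Omega>" and t: "mesh T M t" and U: "\<And>j. j \<le> M \<Longrightarrow> U j \<in> H01 \<Omega>"
    and u: "W11_H01 \<Omega> T u u'"
  shows "W11_H01 \<Omega> T (\<lambda>s x. u s x - pl_interp t M U s x) (\<lambda>s x. u' s x - delta_t t U (mesh_index t M s) x)"
  unfolding W11_H01_def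
proof (intro ballI conjI)
  fix r assume r: "r \<in> {0..T}"
  have dH: "delta_t t U j \<in> H01 \<Omega>" if "j \<le> M" for j
  proof -
    have "(\<lambda>x. inverse (step t j) * (U j x - U (j - 1) x)) \<in> H01 \<Omega>"
      using that by (intro H01_cmult[OF \<Omega>] H01_diff[OF \<Omega>] U) auto
    then show ?thesis by (simp add: delta_t_def divide_inverse mult.commute)
  qed
  have uH: "u r \<in> H01 \<Omega>" and ui: "has_H01_integral \<Omega> {0..r} u' (\<lambda>x. u r x - u 0 x)"
    using u r by (auto simp: W11_H01_def)
  \<comment> \<open>The index 0 makes room for the initial value among the summands.\<close>
  have "(\<lambda>x. \<Sum>j\<in>insert 0 {1..M}. (if j = 0 then 1 else max 0 (min r (t j) - t (j - 1))) *
      (if j = 0 then U 0 else delta_t t U j) x) \<in> H01 \<Omega>"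
    using U dH by (intro H01_sum[OF \<Omega>]) auto
  moreover have "(\<lambda>x. \<Sum>j\<in>insert 0 {1..M}. (if j = 0 then 1 else max 0 (min r (t j) - t (j - 1))) *
      (if j = 0 then U 0 else delta_t t U j) x) = pl_interp t M U r"
    unfolding pl_interp_def by (auto intro!: sum.cong)
  ultimately have "pl_interp t M U r \<in> H01 \<Omega>" by simp
  then show "(\<lambda>x. u r x - pl_interp t M U r x) \<in> H01 \<Omega>" by (intro H01_diff[OF \<Omega> uH])
  let ?c = "\<lambda>s x. delta_t t U (mesh_index t M s) x"
  have S: "{0..r} \<in> lmeasurable" by simp
  have c: "simple_function (lebesgue_on {0..r}) ?c"
    using simple_function_compose1[OF simple_function_mesh_index, of "{0..r}" "\<lambda>j. delta_t t U j" t M] by simp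
  have "mesh_index t M s \<le> M" if "s \<in> {0..r}" for s
  proof (cases "s = 0")
    case True
    have "indicator {t (j - 1)<..t j} s = (0::nat)" if "j \<in> {1..M}" for j
      using mesh_interval(1)[OF t that] True by (auto simp: indicator_def)
    then show ?thesis by (simp add: mesh_index_def)
  next
    case False
    then have "0 < s" "s \<le> T" using that r by auto
    from mesh_intervals_cover[OF t this]
    obtain j where "j \<in> {1..M}" "s \<in> {t (j - 1)<..t j}" .
    from mesh_index_eq[OF t this] this show ?thesis by simp
  qed
  note mi = this
  have cH: "?c ` {0..r} \<subseteq> H01 \<Omega>" by (intro image_subsetI dH mi)
  have I: "(LINT s|lebesgue_on {0..r}. ?c s x) = pl_interp t M U r x - U 0 x" for x
  proof -
    have meas: "measure (lebesgue_on {0..r}) ({t (j - 1)<..t j} \<inter> {0..r}) = max 0 (min r (t j) - t (j - 1))"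
       and em: "emeasure (lebesgue_on {0..r}) ({t (j - 1)<..t j} \<inter> {0..r}) < \<infinity>" if "j \<in> {1..M}" for j
    proof -
      have *: "{t (j - 1)<..t j} \<inter> {0..r} = {t (j - 1)<..min r (t j)}"
        using mesh_interval(1)[OF t that] by auto
      show "measure (lebesgue_on {0..r}) ({t (j - 1)<..t j} \<inter> {0..r}) = max 0 (min r (t j) - t (j - 1))"
        unfolding * using mesh_interval(1)[OF t that]
        by (subst measure_restrict_space) (auto simp: measure_def max_def)
      have "emeasure (lebesgue_on {0..r}) ({t (j - 1)<..t j} \<inter> {0..r}) \<le> emeasure lebesgue {0..r}"
        by (subst emeasure_restrict_space) (auto intro!: emeasure_mono)
      also have "\<dots> < \<infinity>" using fmeasurableD2[OF S] by (simp add: less_top)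
      finally show "emeasure (lebesgue_on {0..r}) ({t (j - 1)<..t j} \<inter> {0..r}) < \<infinity>" .
    qed
    have i: "integrable (lebesgue_on {0..r}) (\<lambda>s. indicator {t (j - 1)<..t j} s * delta_t t U j x)" if "j \<in> {1..M}" for j
    proof (intro integrable_mult_left)
      show "integrable (lebesgue_on {0..r}) (indicat_real {t (j - 1)<..t j})"
        unfolding integrable_indicator_iff using em[OF that] by (simp add: sets_restrict_space_iff)
    qed
    have "(LINT s|lebesgue_on {0..r}. ?c s x)
        = (\<Sum>j=1..M. LINT s|lebesgue_on {0..r}. indicator {t (j - 1)<..t j} s * delta_t t U j x)"
      unfolding delta_t_mesh_index[OF t] by (intro Bochner_Integration.integral_sum i) auto
    also have "\<dots> = (\<Sum>j=1..M. max 0 (min r (t j) - t (j - 1)) * delta_t t U j x)"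
      by (intro sum.cong refl) (simp add: meas del: One_nat_def)
    finally show ?thesis by (simp add: pl_interp_def)
  qed
  have "has_H01_integral \<Omega> {0..r} (\<lambda>s x. u' s x - ?c s x) (\<lambda>x. u r x - u 0 x - (pl_interp t M U r x - U 0 x))"
    using has_H01_integral_diff_simple[OF \<Omega> S ui c cH] unfolding I .
  moreover have "(\<lambda>x. u r x - u 0 x - (pl_interp t M U r x - U 0 x)) =
      (\<lambda>x. u r x - pl_interp t M U r x - (u 0 x - pl_interp t M U 0 x))"
    by (simp add: pl_interp_0[OF t] algebra_simps)
  ultimately show "has_H01_integral \<Omega> {0..r} (\<lambda>s x. u' s x - ?c s x)
      (\<lambda>x. u r x - pl_interp t M U r x - (u 0 x - pl_interp t M U 0 x))" by simp
qed


section \<open>Pairing bounded functions with the Green's function\<close>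

lemma integrable_bounded_mult:
  assumes g: "g \<in> borel_measurable N" and b: "AE x in N. \<bar>g x\<bar> \<le> C" and v: "integrable N (v :: _ \<Rightarrow> real)"
  shows "integrable N (\<lambda>x. g x * v x)"
proof (rule Bochner_Integration.integrable_bound[where f="\<lambda>x. C * v x"])
  show "integrable N (\<lambda>x. C * v x)" using v by simp
  show "(\<lambda>x. g x * v x) \<in> borel_measurable N" using g v by simp
  show "AE x in N. norm (g x * v x) \<le> norm (C * v x)"
    using b
  proof eventually_elim
    case (elim x)
    then have "\<bar>g x\<bar> * \<bar>v x\<bar> \<le> \<bar>C\<bar> * \<bar>v x\<bar>" by (intro mult_right_mono) auto
    then show ?case by (simp add: abs_mult)
  qed
qed

lemma Linf_norm_AE_bound:
  assumes "Linf_norm \<Omega> g < \<infinity>"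
  shows "AE x in lebesgue_on \<Omega>. \<bar>g x\<bar> \<le> enn2real (Linf_norm \<Omega> g)"
  using esssup_AE[of "\<lambda>x. ennreal \<bar>g x\<bar>" "lebesgue_on \<Omega>"]
proof eventually_elim
  case (elim x)
  then have "enn2real (ennreal \<bar>g x\<bar>) \<le> enn2real (Linf_norm \<Omega> g)"
    using assms unfolding Linf_norm_def by (intro enn2real_mono) auto
  then show ?case by simp
qed

lemma abs_L2_inner_le_Linf_L1:
  assumes g: "g \<in> borel_measurable (lebesgue_on \<Omega>)" and v: "v \<in> borel_measurable (lebesgue_on \<Omega>)"
  shows "ennreal \<bar>L2_inner \<Omega> g v\<bar> \<le> Linf_norm \<Omega> g * L1_norm \<Omega> v"
proof -
  have "ennreal \<bar>L2_inner \<Omega> g v\<bar> \<le> (\<integral>\<^sup>+x. ennreal (norm (g x * v x)) \<partial>lebesgue_on \<Omega>)"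
    using integral_norm_bound_ennreal[of "lebesgue_on \<Omega>" "\<lambda>x. g x * v x"]
    by (cases "integrable (lebesgue_on \<Omega>) (\<lambda>x. g x * v x)") (auto simp: L2_inner_def not_integrable_integral_eq)
  also have "\<dots> \<le> (\<integral>\<^sup>+x. Linf_norm \<Omega> g * ennreal \<bar>v x\<bar> \<partial>lebesgue_on \<Omega>)"
  proof (rule nn_integral_mono_AE)
    show "AE x in lebesgue_on \<Omega>. ennreal (norm (g x * v x)) \<le> Linf_norm \<Omega> g * ennreal \<bar>v x\<bar>"
      using esssup_AE[of "\<lambda>x. ennreal \<bar>g x\<bar>" "lebesgue_on \<Omega>"]
      by eventually_elim (auto simp: abs_mult ennreal_mult' Linf_norm_def intro: mult_right_mono)
  qed
  also have "\<dots> = Linf_norm \<Omega> g * L1_norm \<Omega> v"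
    unfolding L1_norm_def using v by (intro nn_integral_cmult) simp
  finally show ?thesis .
qed

text \<open>
  Pairing with a bounded function is continuous with respect to the \<open>L\<^sub>1\<close> norm, and the
  difference quotients converge in this norm.
\<close>

lemma has_real_derivative_L2_inner:
  assumes g: "g \<in> borel_measurable (lebesgue_on \<Omega>)" "Linf_norm \<Omega> g < \<infinity>"
    and w: "\<And>s. s > 0 \<Longrightarrow> integrable (lebesgue_on \<Omega>) (w s)" and "t > 0"
    and d: "has_L1_time_deriv \<Omega> w d t"
  shows "((\<lambda>s. L2_inner \<Omega> g (w s)) has_real_derivative L2_inner \<Omega> g d) (at t)"
proof -
  let ?F = "\<lambda>s. L2_inner \<Omega> g (w s)"
  let ?q = "\<lambda>h y. (w (t + h) y - w t y) / h - d y"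
  have di: "integrable (lebesgue_on \<Omega>) d"
    and lim: "((\<lambda>h. L1_norm \<Omega> (?q h)) \<longlongrightarrow> 0) (at 0)"
    using d by (auto simp: has_L1_time_deriv_def)
  note gi = integrable_bounded_mult[OF g(1) Linf_norm_AE_bound[OF g(2)]]
  have "\<forall>\<^sub>F h in at 0. \<bar>h\<bar> < t"
    using \<open>t > 0\<close> eventually_at_ball[of t "0::real" UNIV] by (auto elim: eventually_mono)
  then have le: "\<forall>\<^sub>F h in at 0. ennreal \<bar>(?F (t + h) - ?F t) / h - L2_inner \<Omega> g d\<bar> \<le> Linf_norm \<Omega> g * L1_norm \<Omega> (?q h)"
  proof eventually_elim
    case (elim h)
    then have i: "integrable (lebesgue_on \<Omega>) (w (t + h))" "integrable (lebesgue_on \<Omega>) (w t)"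
      using \<open>t > 0\<close> by (auto intro!: w)
    have "(?F (t + h) - ?F t) / h - L2_inner \<Omega> g d =
       (LINT x|lebesgue_on \<Omega>. (g x * w (t + h) x - g x * w t x) / h - g x * d x)"
      using gi[OF i(1)] gi[OF i(2)] gi[OF di] unfolding L2_inner_def by simp
    also have "\<dots> = L2_inner \<Omega> g (?q h)"
      unfolding L2_inner_def by (intro Bochner_Integration.integral_cong refl) (simp add: algebra_simps diff_divide_distrib)
    finally show ?case
      using abs_L2_inner_le_Linf_L1[OF g(1), of "?q h"] i di by simp
  qed
  have "((\<lambda>h. Linf_norm \<Omega> g * L1_norm \<Omega> (?q h)) \<longlongrightarrow> Linf_norm \<Omega> g * 0) (at 0)"
    using g(2) by (intro ennreal_tendsto_cmult lim) auto
  then have lim0: "((\<lambda>h. Linf_norm \<Omega> g * L1_norm \<Omega> (?q h)) \<longlongrightarrow> 0) (at 0)" by simp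
  have "((\<lambda>h. ennreal \<bar>(?F (t + h) - ?F t) / h - L2_inner \<Omega> g d\<bar>) \<longlongrightarrow> ennreal 0) (at 0)"
    unfolding ennreal_0 by (rule tendsto_sandwich[OF _ le tendsto_const lim0]) simp
  then have "((\<lambda>h. \<bar>(?F (t + h) - ?F t) / h - L2_inner \<Omega> g d\<bar>) \<longlongrightarrow> 0) (at 0)"
    by (rule tendsto_ennrealD) auto
  then have "((\<lambda>h. (?F (t + h) - ?F t) / h - L2_inner \<Omega> g d) \<longlongrightarrow> 0) (at 0)"
    by (simp add: tendsto_rabs_zero_iff)
  then show ?thesis unfolding DERIV_def by (simp add: LIM_zero_iff)
qed

lemma test_fun_Linf_finite:
  assumes "\<Omega> \<in> sets lebesgue" "test_fun \<Omega> \<phi> D"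
  shows "\<phi> \<in> borel_measurable (lebesgue_on \<Omega>)" "Linf_norm \<Omega> \<phi> < \<infinity>"
proof -
  show m: "\<phi> \<in> borel_measurable (lebesgue_on \<Omega>)"
    using test_fun_L2(1)[OF assms] by (simp add: L2_def)
  let ?K = "closure {x. \<phi> x \<noteq> 0}"
  have "continuous_on ?K \<phi>" using continuous_on_subset[OF test_fun_props(1)[OF assms(2)] subset_UNIV] .
  from compact_continuous_image[OF this test_fun_props(3)[OF assms(2)]]
  have "bounded (\<phi> ` ?K)" by (rule compact_imp_bounded)
  then obtain C where C: "\<And>x. x \<in> ?K \<Longrightarrow> \<bar>\<phi> x\<bar> \<le> C" unfolding bounded_iff by auto
  have "\<bar>\<phi> x\<bar> \<le> max C 0" for x
    using C[of x] test_fun_props(4)[OF assms(2), of x] by (cases "x \<in> ?K") auto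
  then have "Linf_norm \<Omega> \<phi> \<le> ennreal (max C 0)"
    unfolding Linf_norm_def using m by (intro esssup_I AE_I2) (auto intro: ennreal_leI)
  then show "Linf_norm \<Omega> \<phi> < \<infinity>" using le_less_trans by fastforce
qed


section \<open>The constants in the bounds for the Green's function\<close>

text \<open>
  Test functions that tend to the indicator of the null set \<open>{x}\<close> have the value 1 at
  \<open>x\<close> in the limit, while their integrals against \<open>v\<close> tend to zero.
\<close>

lemma no_L2_delta:
  assumes \<Omega>: "open \<Omega>" "x \<in> \<Omega>" and v: "v \<in> L2 \<Omega>"
  shows "\<not> (\<forall>\<phi> D. test_fun \<Omega> \<phi> D \<longrightarrow> L2_inner \<Omega> v \<phi> = \<phi> x)"
proof
  assume A: "\<forall>\<phi> D. test_fun \<Omega> \<phi> D \<longrightarrow> L2_inner \<Omega> v \<phi> = \<phi> x"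
  have ms: "\<Omega> \<in> sets lebesgue" using \<Omega> by (simp add: borel_open)
  have K: "compact {x}" "{x} \<subseteq> \<Omega>" using \<Omega> by auto
  obtain \<phi> D K' where \<phi>: "\<And>k::nat. test_fun \<Omega> (\<phi> k) (D k)"
    "\<And>k y. 0 \<le> \<phi> k y" "\<And>k y. \<phi> k y \<le> 1" "compact K'" "K' \<subseteq> \<Omega>" "\<And>k y. y \<notin> K' \<Longrightarrow> \<phi> k y = 0"
    "\<And>y. (\<lambda>k. \<phi> k y) \<longlonglongrightarrow> indicator {x} y"
    by (rule compact_indicator_limit_of_test_funs[OF \<Omega>(1) K]) blast
  have K'L2: "(\<lambda>y. indicator K' y :: real) \<in> L2 \<Omega>"
    by (rule indicator_compact_L2[OF ms \<phi>(4)])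
  have "(\<lambda>k. LINT y|lebesgue_on \<Omega>. v y * \<phi> k y) \<longlonglongrightarrow> (LINT y|lebesgue_on \<Omega>. v y * indicator {x} y)"
  proof (rule integral_dominated_convergence[where w="\<lambda>y. \<bar>v y * indicator K' y\<bar>"])
    show "(\<lambda>y. v y * indicator {x} y) \<in> borel_measurable (lebesgue_on \<Omega>)"
      using indicator_compact_L2[OF ms K(1)] v by (intro borel_measurable_times) (auto simp: L2_def)
    show "(\<lambda>y. v y * \<phi> k y) \<in> borel_measurable (lebesgue_on \<Omega>)" for k
      using test_fun_L2(1)[OF ms \<phi>(1)] v by (intro borel_measurable_times) (auto simp: L2_def)
    show "integrable (lebesgue_on \<Omega>) (\<lambda>y. \<bar>v y * indicator K' y\<bar>)"
      by (rule integrable_abs[OF L2_mult_integrable[OF v K'L2]])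
    show "AE y in lebesgue_on \<Omega>. (\<lambda>k. v y * \<phi> k y) \<longlonglongrightarrow> v y * indicator {x} y"
      by (intro AE_I2 tendsto_mult \<phi>(7) tendsto_const)
    have "norm (v y * \<phi> k y) \<le> \<bar>v y * indicator K' y\<bar>" for k y
      using \<phi>(2,3)[of k y] \<phi>(6)[of y k] by (cases "y \<in> K'") (auto simp: abs_mult mult_left_le)
    then show "AE y in lebesgue_on \<Omega>. norm (v y * \<phi> k y) \<le> \<bar>v y * indicator K' y\<bar>" for k
      by (intro AE_I2)
  qed
  moreover have "(LINT y|lebesgue_on \<Omega>. v y * \<phi> k y) = \<phi> k x" for k
    using A[rule_format, OF \<phi>(1)[of k]] by (simp only: L2_inner_def)
  moreover have "(LINT y|lebesgue_on \<Omega>. v y * indicator {x} y) = 0"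
  proof -
    have "AE y in lebesgue. y \<notin> {x}"
      by (rule AE_not_in) (simp add: null_sets_completionI)
    then have "AE y in lebesgue_on \<Omega>. v y * indicator {x} y = 0"
      using ms by (auto simp: AE_restrict_space_iff elim!: eventually_mono)
    then show ?thesis by (rule integral_eq_zero_AE)
  qed
  ultimately have "(\<lambda>k. \<phi> k x) \<longlonglongrightarrow> 0" by simp
  moreover have "(\<lambda>k. \<phi> k x) \<longlonglongrightarrow> 1" using \<phi>(7)[of x] by simp
  ultimately show False using LIMSEQ_unique by fastforce
qed

text \<open>
  If \<open>\<kappa>\<^sub>0 = 0\<close>, then \<open>G\<close> is zero almost everywhere; if
  \<open>\<kappa>\<^sub>1 = \<kappa>\<^sub>1' = 0\<close>, then its time derivative is, on the time interval
  where the bounds hold. In both cases the pairing of \<open>G\<close> with any test function is constant on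
  \<open>(0, T)\<close>, so by the initial condition it equals the value at \<open>x\<close>: the element
  \<open>G x (T / 2)\<close> of \<open>L2\<close> would be the Dirac distribution.
\<close>

lemma green_constants_pos:
  assumes \<Omega>: "open \<Omega>" "x \<in> \<Omega>" and "T > 0" and G: "green_function \<Omega> L G dG"
    and B: "green_bounds \<Omega> T G dG \<kappa>\<^sub>0 \<kappa>\<^sub>1 \<kappa>\<^sub>1' \<gamma>"
  shows "\<kappa>\<^sub>0 > 0" "\<kappa>\<^sub>1 > 0 \<or> \<kappa>\<^sub>1' > 0"
proof -
  have ms: "\<Omega> \<in> sets lebesgue" using \<Omega> by (simp add: borel_open)
  have G1: "G x s \<in> H01 \<Omega>" "integrable (lebesgue_on \<Omega>) (G x s)" "has_L1_time_deriv \<Omega> (G x) (dG x s) s" if "s > 0" for s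
    using G \<Omega>(2) that by (auto simp: green_function_def)
  have G0: "((\<lambda>s. L2_inner \<Omega> (G x s) \<phi>) \<longlongrightarrow> \<phi> x) (at_right 0)" if "test_fun \<Omega> \<phi> D" for \<phi> D
    using G[unfolded green_function_def, THEN bspec, OF \<Omega>(2), THEN conjunct2, rule_format, OF that] .
  have nn: "\<kappa>\<^sub>0 \<ge> 0" "\<kappa>\<^sub>1 \<ge> 0" "\<kappa>\<^sub>1' \<ge> 0" using B by (auto simp: green_bounds_def)
  have comm: "L2_inner \<Omega> v w = L2_inner \<Omega> w v" for v w by (simp add: L2_inner_def mult.commute)
  have const: False if c: "\<And>\<phi> D s. test_fun \<Omega> \<phi> D \<Longrightarrow> 0 < s \<Longrightarrow> s < T \<Longrightarrow> L2_inner \<Omega> (G x s) \<phi> = L2_inner \<Omega> (G x (T/2)) \<phi>"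
  proof -
    have "L2_inner \<Omega> (G x (T/2)) \<phi> = \<phi> x" if t: "test_fun \<Omega> \<phi> D" for \<phi> D
    proof (rule tendsto_unique[OF _ _ G0[OF t]])
      have "\<forall>\<^sub>F s in at_right 0. L2_inner \<Omega> (G x s) \<phi> = L2_inner \<Omega> (G x (T/2)) \<phi>"
        by (rule eventually_at_rightI[OF _ \<open>T > 0\<close>]) (auto intro: c[OF t])
      then show "((\<lambda>s. L2_inner \<Omega> (G x s) \<phi>) \<longlongrightarrow> L2_inner \<Omega> (G x (T/2)) \<phi>) (at_right 0)"
        by (rule tendsto_eventually)
    qed simp
    then show False using no_L2_delta[OF \<Omega> H01_L2[OF G1(1)[of "T/2"]]] \<open>T > 0\<close> by auto
  qed
  show "\<kappa>\<^sub>0 > 0"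
  proof (rule ccontr)
    assume "\<not> \<kappa>\<^sub>0 > 0"
    then have k: "\<kappa>\<^sub>0 = 0" using nn by simp
    have z: "L2_inner \<Omega> (G x s) \<phi> = 0" if "test_fun \<Omega> \<phi> D" "0 < s" "s < T" for \<phi> D s
    proof -
      have "L1_norm \<Omega> (G x s) = 0" using B \<Omega>(2) that k by (force simp: green_bounds_def)
      then have "ennreal \<bar>L2_inner \<Omega> \<phi> (G x s)\<bar> \<le> 0"
        using abs_L2_inner_le_Linf_L1[OF test_fun_Linf_finite(1)[OF ms that(1)], of "G x s"] G1(2)[OF that(2)] by simp
      then show ?thesis by (simp add: comm)
    qed
    show False using z \<open>T > 0\<close> by (intro const) simp
  qed
  show "\<kappa>\<^sub>1 > 0 \<or> \<kappa>\<^sub>1' > 0"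
  proof (rule ccontr)
    assume "\<not> (\<kappa>\<^sub>1 > 0 \<or> \<kappa>\<^sub>1' > 0)"
    then have k: "\<kappa>\<^sub>1 = 0" "\<kappa>\<^sub>1' = 0" using nn by auto
    show False
    proof (rule const)
      fix \<phi> D s assume t: "test_fun \<Omega> \<phi> D" and s: "0 < s" "s < T"
      note pf = test_fun_Linf_finite[OF ms t]
      have "((\<lambda>s. L2_inner \<Omega> \<phi> (G x s)) has_real_derivative 0) (at r within {0<..<T})" if r: "r \<in> {0<..<T}" for r
      proof -
        have "L1_norm \<Omega> (dG x r) = 0" using B \<Omega>(2) r k by (force simp: green_bounds_def)
        moreover have "dG x r \<in> borel_measurable (lebesgue_on \<Omega>)"
          using G1(3)[of r] r by (auto simp: has_L1_time_deriv_def)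
        ultimately have "L2_inner \<Omega> \<phi> (dG x r) = 0"
          using abs_L2_inner_le_Linf_L1[OF pf(1), of "dG x r"] by simp
        with has_real_derivative_L2_inner[OF pf, of "G x" r "dG x r"] G1 r
        show ?thesis by (auto intro: has_field_derivative_at_within)
      qed
      then obtain c where "\<And>r. r \<in> {0<..<T} \<Longrightarrow> L2_inner \<Omega> \<phi> (G x r) = c"
        using has_field_derivative_zero_constant[of "{0<..<T}" "\<lambda>s. L2_inner \<Omega> \<phi> (G x s)"] by auto
      from this[of s] this[of "T/2"] s show "L2_inner \<Omega> (G x s) \<phi> = L2_inner \<Omega> (G x (T/2)) \<phi>"
        by (simp add: comm)
    qed
  qed
qed


section \<open>Weighted integrals over one mesh interval\<close>

lemma bounded_continuous_Ioo_integrable: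
  fixes f :: "real \<Rightarrow> real"
  assumes f: "continuous_on {a<..<b} f" and C: "\<And>s. s \<in> {a<..<b} \<Longrightarrow> \<bar>f s\<bar> \<le> C"
  shows "integrable (lebesgue_on {a<..<b}) f" "f integrable_on {a..b}"
    "(LINT s|lebesgue_on {a<..<b}. f s) = integral {a..b} f"
proof -
  have m: "f \<in> borel_measurable (lebesgue_on {a<..<b})"
    by (rule continuous_imp_measurable_on_sets_lebesgue[OF f]) simp
  have fm: "finite_measure (lebesgue_on {a<..<b})"
    by (rule finite_measure_lebesgue_on) simp
  show i: "integrable (lebesgue_on {a<..<b}) f"
    by (rule finite_measure.integrable_const_bound[OF fm _ m, of C]) (auto intro!: AE_I2 C)
  then have "f integrable_on {a<..<b}"
    using integrable_on_lebesgue_on[OF i] by simp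
  then show "f integrable_on {a..b}" by (simp add: integrable_on_Icc_iff_Ioo)
  have "(LINT s|lebesgue_on {a<..<b}. f s) = integral {a<..<b} f"
    by (rule lebesgue_integral_eq_integral[OF i]) simp
  then show "(LINT s|lebesgue_on {a<..<b}. f s) = integral {a..b} f"
    by (simp add: integral_open_interval_real)
qed

lemma has_integral_quadratic_weight:
  fixes a b :: real
  assumes "a \<le> b"
  shows "((\<lambda>s. (b - s) * (s - a)) has_integral (b - a) ^ 3 / 6) {a..b}"
proof -
  let ?P = "\<lambda>s. (s - a)\<^sup>2 * (b - a) / 2 - (s - a) ^ 3 / 3"
  have "((\<lambda>s. (b - s) * (s - a)) has_integral ?P b - ?P a) {a..b}"
  proof (rule fundamental_theorem_of_calculus[OF assms])
    fix s assume "s \<in> {a..b}"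
    have "(?P has_real_derivative (b - s) * (s - a)) (at s)"
      by (auto intro!: derivative_eq_intros) (simp add: field_simps power2_eq_square)
    then show "(?P has_vector_derivative (b - s) * (s - a)) (at s within {a..b})"
      unfolding has_real_derivative_iff_has_vector_derivative by (rule has_vector_derivative_at_within)
  qed
  also have "?P b - ?P a = (b - a) ^ 3 / 6" by (simp add: field_simps power2_eq_square power3_eq_cube)
  finally show ?thesis .
qed

lemma quadratic_weight_quotient_integrable:
  fixes a b T :: real
  assumes "a < b" "b \<le> T"
  shows "(\<lambda>s. (b - s) * (s - a) / (T - s)) integrable_on {a..b}"
proof (cases "b = T")
  case True
  have "(\<lambda>s. s - a) integrable_on {a..b}" by (intro integrable_continuous_interval continuous_intros)
  then show ?thesis
    by (rule integrable_spike_finite[of "{b}", rotated 2]) (auto simp: True)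
next
  case False
  then show ?thesis using assms by (intro integrable_continuous_interval continuous_intros) auto
qed

text \<open>
  The product of the bubble \<open>(b - s) (s - a)\<close> with \<open>D\<close> vanishes at both ends. At
  \<open>b\<close> this needs only that \<open>D\<close> is bounded; nothing is known about \<open>D\<close>
  at \<open>b\<close> itself, and for \<open>b = T\<close> its derivative may blow up there like \<open>1 / (T
  - s)\<close>. The gauge integral is used because the fundamental theorem of calculus then yields the
  integrability of the bubble times \<open>D'\<close> along with the value of the integral.
\<close>

lemma by_parts_bound:
  fixes D D' :: "real \<Rightarrow> real"
  assumes ab: "a < b" "b \<le> T"
    and deriv: "\<And>s. s \<in> {a..<b} \<Longrightarrow> (D has_real_derivative D' s) (at s)"
    and D: "\<And>s. s \<in> {a..<b} \<Longrightarrow> \<bar>D s\<bar> \<le> C"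
    and D': "\<And>s. s \<in> {a<..<b} \<Longrightarrow> \<bar>D' s\<bar> \<le> B * (k / (T - s) + k')"
  shows "\<bar>integral {a..b} (\<lambda>s. ((a + b) / 2 - s) * D s)\<bar>
     \<le> B / 2 * (k * integral {a..b} (\<lambda>s. (b - s) * (s - a) / (T - s)) + k' * ((b - a) ^ 3 / 6))"
proof -
  let ?Q = "\<lambda>s. (b - s) * (s - a)"
  have Dc: "isCont D s" if "s \<in> {a..<b}" for s using DERIV_isCont[OF deriv[OF that]] .
  have cont: "continuous_on {a..b} (\<lambda>s. ?Q s * D s)"
    unfolding continuous_on_eq_continuous_within
  proof
    fix s assume s: "s \<in> {a..b}"
    show "continuous (at s within {a..b}) (\<lambda>s. ?Q s * D s)"
    proof (cases "s = b")
      case False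
      then have "isCont (\<lambda>s. ?Q s * D s) s" using s Dc by (intro continuous_intros) auto
      then show ?thesis by (rule continuous_at_imp_continuous_at_within)
    next
      case True
      have "((\<lambda>s. ?Q s * D s) \<longlongrightarrow> 0) (at b within {a..b})"
      proof (rule Lim_null_comparison[where g="\<lambda>s. ?Q s * C"])
        have "norm (?Q r * D r) \<le> ?Q r * C" if "r \<in> {a..b}" "r \<noteq> b" for r
          using D[of r] that by (auto simp: abs_mult intro!: mult_left_mono)
        then show "\<forall>\<^sub>F r in at b within {a..b}. norm (?Q r * D r) \<le> ?Q r * C"
          by (auto simp: eventually_at_filter)
        have "((\<lambda>s. ?Q s * C) \<longlongrightarrow> ?Q b * C) (at b within {a..b})" by (intro tendsto_intros)
        then show "((\<lambda>s. ?Q s * C) \<longlongrightarrow> 0) (at b within {a..b})" by simp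
      qed
      then show ?thesis using True by (simp add: continuous_within)
    qed
  qed
  \<comment> \<open>The product rule; the boundary terms on the right are zero.\<close>
  have F: "((\<lambda>s. (a + b - 2 * s) * D s + ?Q s * D' s) has_integral ?Q b * D b - ?Q a * D a) {a..b}"
  proof (rule fundamental_theorem_of_calculus_interior[OF less_imp_le[OF ab(1)] cont])
    fix s assume s: "s \<in> {a<..<b}"
    have "((\<lambda>s. ?Q s * D s) has_real_derivative (a + b - 2 * s) * D s + ?Q s * D' s) (at s)"
      using s by (auto intro!: derivative_eq_intros deriv simp: algebra_simps)
    then show "((\<lambda>s. ?Q s * D s) has_vector_derivative (a + b - 2 * s) * D s + ?Q s * D' s) (at s)"
      by (simp add: has_real_derivative_iff_has_vector_derivative)
  qed
  have i1: "(\<lambda>s. (a + b - 2 * s) * D s) integrable_on {a..b}"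
  proof (rule bounded_continuous_Ioo_integrable(2))
    have "continuous_on {a<..<b} D" using Dc by (intro continuous_at_imp_continuous_on) auto
    then show "continuous_on {a<..<b} (\<lambda>s. (a + b - 2 * s) * D s)" by (intro continuous_intros)
    fix s assume s: "s \<in> {a<..<b}"
    have "\<bar>a + b - 2 * s\<bar> \<le> b - a" using s by auto
    then show "\<bar>(a + b - 2 * s) * D s\<bar> \<le> (b - a) * C"
      using D[of s] s by (auto simp: abs_mult intro!: mult_mono)
  qed
  have "((\<lambda>s. ?Q s * D' s) has_integral - integral {a..b} (\<lambda>s. (a + b - 2 * s) * D s)) {a..b}"
    using has_integral_diff[OF F integrable_integral[OF i1]] by simp
  then have i2: "(\<lambda>s. ?Q s * D' s) integrable_on {a..b}"
    and e: "integral {a..b} (\<lambda>s. ?Q s * D' s) = - integral {a..b} (\<lambda>s. (a + b - 2 * s) * D s)"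
    by (auto simp: has_integral_integrable_integral)
  have q1: "(\<lambda>s. ?Q s / (T - s)) integrable_on {a..b}"
    by (rule quadratic_weight_quotient_integrable[OF ab])
  have q2: "(?Q has_integral (b - a) ^ 3 / 6) {a..b}"
    using ab by (intro has_integral_quadratic_weight) simp
  have g: "((\<lambda>s. B * (k * (?Q s / (T - s)) + k' * ?Q s)) has_integral
      B * (k * integral {a..b} (\<lambda>s. ?Q s / (T - s)) + k' * ((b - a) ^ 3 / 6))) {a..b}"
    by (intro has_integral_mult_right has_integral_add integrable_integral q1 q2)
  have "norm (integral {a..b} (\<lambda>s. ?Q s * D' s)) \<le> integral {a..b} (\<lambda>s. B * (k * (?Q s / (T - s)) + k' * ?Q s))"
  proof (rule integral_norm_bound_integral[OF i2 has_integral_integrable[OF g]])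
    fix s assume s: "s \<in> {a..b}"
    show "norm (?Q s * D' s) \<le> B * (k * (?Q s / (T - s)) + k' * ?Q s)"
    proof (cases "s = a \<or> s = b")
      case False
      then have "s \<in> {a<..<b}" using s by auto
      then have "?Q s * \<bar>D' s\<bar> \<le> ?Q s * (B * (k / (T - s) + k'))"
        by (intro mult_left_mono D') auto
      moreover have "norm (?Q s * D' s) = ?Q s * \<bar>D' s\<bar>" using s by (simp add: abs_mult)
      moreover have "?Q s * (B * (k / (T - s) + k')) = B * (k * (?Q s / (T - s)) + k' * ?Q s)"
        by (simp only: distrib_left times_divide_eq_right mult.assoc mult.left_commute mult.commute)
      ultimately show ?thesis by simp
    qed auto
  qed
  then have "\<bar>integral {a..b} (\<lambda>s. (a + b - 2 * s) * D s)\<bar>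
      \<le> B * (k * integral {a..b} (\<lambda>s. ?Q s / (T - s)) + k' * ((b - a) ^ 3 / 6))"
    unfolding e integral_unique[OF g] by simp
  moreover have "integral {a..b} (\<lambda>s. ((a + b) / 2 - s) * D s) = integral {a..b} (\<lambda>s. 1 / 2 * ((a + b - 2 * s) * D s))"
    by (rule arg_cong[where f="integral {a..b}"]) (auto simp: field_simps)
  moreover have "\<dots> = 1 / 2 * integral {a..b} (\<lambda>s. (a + b - 2 * s) * D s)" by (rule integral_mult_right)
  ultimately show ?thesis by (simp add: abs_mult)
qed

lemma deriv_quadratic_weight: "deriv (\<lambda>r. (b - r) * (r - a)) s = a + b - 2 * (s::real)"
  by (rule DERIV_imp_deriv) (auto intro!: derivative_eq_intros)

lemma midpoint_weight_bound:
  fixes D :: "real \<Rightarrow> real"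
  assumes ab: "a < b" and Dc: "continuous_on {a<..<b} D" and D: "\<And>s. s \<in> {a<..<b} \<Longrightarrow> \<bar>D s\<bar> \<le> C"
  shows "\<bar>integral {a..b} (\<lambda>s. ((a + b) / 2 - s) * D s)\<bar>
     \<le> C / 2 * integral {a..b} (\<lambda>s. \<bar>deriv (\<lambda>r. (b - r) * (r - a)) s\<bar>)"
proof -
  have 1: "(\<lambda>s. ((a + b) / 2 - s) * D s) integrable_on {a..b}"
  proof (rule bounded_continuous_Ioo_integrable(2))
    show "continuous_on {a<..<b} (\<lambda>s. ((a + b) / 2 - s) * D s)" by (intro continuous_intros Dc)
    fix s assume s: "s \<in> {a<..<b}"
    have "\<bar>(a + b) / 2 - s\<bar> \<le> b - a" using s by (auto simp: field_simps abs_if)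
    then show "\<bar>((a + b) / 2 - s) * D s\<bar> \<le> (b - a) * C"
      using D[of s] s by (auto simp: abs_mult intro!: mult_mono)
  qed
  have i: "(\<lambda>s. C / 2 * \<bar>a + b - 2 * s\<bar>) integrable_on {a<..<b}" "(\<lambda>s. ((a + b) / 2 - s) * D s) integrable_on {a<..<b}"
    using 1 by (auto simp flip: integrable_on_Icc_iff_Ioo intro!: integrable_continuous_interval continuous_intros)
  have "norm (integral {a<..<b} (\<lambda>s. ((a + b) / 2 - s) * D s)) \<le> integral {a<..<b} (\<lambda>s. C / 2 * \<bar>a + b - 2 * s\<bar>)"
  proof (rule integral_norm_bound_integral[OF i(2,1)])
    fix s assume "s \<in> {a<..<b}"
    from mult_left_mono[OF D[OF this], of "\<bar>a + b - 2 * s\<bar> / 2"]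
    show "norm (((a + b) / 2 - s) * D s) \<le> C / 2 * \<bar>a + b - 2 * s\<bar>"
      by (simp add: abs_mult field_simps flip: abs_mult)
  qed
  then show ?thesis unfolding deriv_quadratic_weight by (simp add: integral_open_interval_real)
qed

text \<open>
  Positivity excludes the product \<open>0 \<cdot> \<infinity> = 0\<close> in the estimator. The integral in
  \<open>Phi1\<close> is compared with the one that has \<open>T\<close> in place of \<open>T - s\<close> in
  the denominator.
\<close>

lemma Psi1_pos:
  assumes t: "mesh T M t" and j: "j \<in> {1..M}" and k: "\<kappa>\<^sub>0 > 0" "\<kappa>\<^sub>1 \<ge> 0" "\<kappa>\<^sub>1' \<ge> 0" "\<kappa>\<^sub>1 > 0 \<or> \<kappa>\<^sub>1' > 0"
  shows "Psi1 \<kappa>\<^sub>0 \<kappa>\<^sub>1 \<kappa>\<^sub>1' T t j > 0"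
proof -
  define a b where "a = t (j - 1)" and "b = t j"
  have ab: "0 \<le> a" "a < b" "b \<le> T" using mesh_interval[OF t j] by (auto simp: a_def b_def)
  let ?q = "\<lambda>s. (b - s) * (s - a) / (T - s)"
  have c: "(b - a) ^ 3 / 6 > 0" using ab by simp
  have "(b - a) ^ 3 / 6 / T \<le> integral {a..b} ?q"
  proof (rule has_integral_le)
    show "((\<lambda>s. (b - s) * (s - a) / T) has_integral (b - a) ^ 3 / 6 / T) {a..b}"
      by (rule has_integral_divide[OF has_integral_quadratic_weight[OF less_imp_le[OF ab(2)]]])
    show "(?q has_integral integral {a..b} ?q) {a..b}"
      by (rule integrable_integral[OF quadratic_weight_quotient_integrable[OF ab(2,3)]])
    fix s assume s: "s \<in> {a..b}"
    show "(b - s) * (s - a) / T \<le> ?q s"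
    proof (cases "s = T")
      \<comment> \<open>At \<open>s = b = T\<close> both sides are zero, the right one because \<open>0 / 0 = 0\<close>.\<close>
      case True
      then have "b = s" using s ab by simp
      then show ?thesis by simp
    next
      case False
      then have *: "0 < T - s" "T - s \<le> T" "0 \<le> (b - s) * (s - a)" using s ab by auto
      then have "0 < T" by linarith
      with * show ?thesis by (intro divide_left_mono[OF *(2,3)] mult_pos_pos)
    qed
  qed
  moreover have "(b - a) ^ 3 / 6 / T > 0" using c ab by (intro divide_pos_pos) auto
  ultimately have qpos: "integral {a..b} ?q > 0" by linarith
  have 1: "Phi1 \<kappa>\<^sub>1 \<kappa>\<^sub>1' T t j > 0"
    unfolding Phi1_def step_def a_def[symmetric] b_def[symmetric]
    using k(4)
  proof
    assume "\<kappa>\<^sub>1 > 0"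
    then show "0 < \<kappa>\<^sub>1 * integral {a..b} ?q + \<kappa>\<^sub>1' * ((b - a) ^ 3 / 6)"
      using c k(3) qpos by (intro add_pos_nonneg mult_pos_pos mult_nonneg_nonneg) linarith+
  next
    assume "\<kappa>\<^sub>1' > 0"
    then show "0 < \<kappa>\<^sub>1 * integral {a..b} ?q + \<kappa>\<^sub>1' * ((b - a) ^ 3 / 6)"
      using c k(2) qpos by (intro add_nonneg_pos mult_pos_pos mult_nonneg_nonneg) linarith+
  qed
  have "integral {a..b} (\<lambda>s. \<bar>a + b - 2 * s\<bar>) \<noteq> 0"
  proof
    assume "integral {a..b} (\<lambda>s. \<bar>a + b - 2 * s\<bar>) = 0"
    then have "\<forall>s\<in>{a..b}. \<bar>a + b - 2 * s\<bar> = 0"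
      using ab by (subst (asm) integral_eq_0_iff) (auto intro!: continuous_intros)
    from bspec[OF this, of a] ab have "\<bar>a + b - 2 * a\<bar> = 0" by simp
    then show False using ab by simp
  qed
  moreover have "integral {a..b} (\<lambda>s. \<bar>a + b - 2 * s\<bar>) \<ge> 0"
    by (intro Henstock_Kurzweil_Integration.integral_nonneg integrable_continuous_interval continuous_intros) auto
  ultimately have 2: "Phi1_star \<kappa>\<^sub>0 t j > 0"
    using k(1) unfolding Phi1_star_def deriv_quadratic_weight a_def[symmetric] b_def[symmetric] by simp
  from 1 2 show ?thesis by (simp add: Psi1_def)
qed


section \<open>Estimates for extended nonnegative integrals\<close>

text \<open>
  \<open>F\<close> may fail to be measurable, in which case its integral is the supremum over the simple
  functions below it. The division by \<open>c\<close> takes place on the measurable side, so that the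
  constant can be pulled out of the integral.
\<close>

lemma interval_contribution_bound:
  fixes p h q :: "real \<Rightarrow> real" and F :: "real \<Rightarrow> ennreal"
  assumes p: "integrable N p" and q: "integrable N q" and "c > 0"
    and eq: "AE s in N. p s = h s + q s" and h: "AE s in N. ennreal \<bar>h s\<bar> \<le> ennreal c * F s"
  shows "ennreal \<bar>LINT s|N. p s\<bar> \<le> ennreal c * (\<integral>\<^sup>+s. F s \<partial>N) + ennreal \<bar>LINT s|N. q s\<bar>"
proof -
  let ?h = "\<lambda>s. p s - q s"
  have hi: "integrable N ?h" using p q by simp
  have [measurable]: "?h \<in> borel_measurable N" using hi by simp
  have c: "ennreal c * ennreal (inverse c) = 1" using \<open>c > 0\<close> by (simp flip: ennreal_mult)
  have "AE s in N. ennreal (inverse c * \<bar>?h s\<bar>) \<le> F s"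
    using eq h
  proof eventually_elim
    case (elim s)
    have "ennreal (inverse c * \<bar>?h s\<bar>) = ennreal (inverse c) * ennreal \<bar>h s\<bar>"
      using elim(1) \<open>c > 0\<close> by (simp add: ennreal_mult)
    also have "\<dots> \<le> ennreal (inverse c) * (ennreal c * F s)" by (rule mult_left_mono[OF elim(2)]) simp
    also have "\<dots> = F s" using c by (simp add: mult.assoc[symmetric] mult.commute)
    finally show ?case .
  qed
  from nn_integral_mono_AE[OF this]
  have le: "(\<integral>\<^sup>+s. ennreal (inverse c * \<bar>?h s\<bar>) \<partial>N) \<le> (\<integral>\<^sup>+s. F s \<partial>N)" .
  have "ennreal \<bar>LINT s|N. ?h s\<bar> \<le> (\<integral>\<^sup>+s. ennreal (norm (?h s)) \<partial>N)"
    using integral_norm_bound_ennreal[OF hi] by simp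
  also have "\<dots> = (\<integral>\<^sup>+s. ennreal c * ennreal (inverse c * \<bar>?h s\<bar>) \<partial>N)"
    using \<open>c > 0\<close> by (intro nn_integral_cong) (simp flip: ennreal_mult)
  also have "\<dots> = ennreal c * (\<integral>\<^sup>+s. ennreal (inverse c * \<bar>?h s\<bar>) \<partial>N)"
    by (intro nn_integral_cmult) measurable
  also have "\<dots> \<le> ennreal c * (\<integral>\<^sup>+s. F s \<partial>N)" by (rule mult_left_mono[OF le]) simp
  finally have 1: "ennreal \<bar>LINT s|N. ?h s\<bar> \<le> ennreal c * (\<integral>\<^sup>+s. F s \<partial>N)" .
  have "\<bar>LINT s|N. p s\<bar> \<le> \<bar>LINT s|N. ?h s\<bar> + \<bar>LINT s|N. q s\<bar>"
    using p q by simp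
  then have "ennreal \<bar>LINT s|N. p s\<bar> \<le> ennreal \<bar>LINT s|N. ?h s\<bar> + ennreal \<bar>LINT s|N. q s\<bar>"
    by (simp flip: ennreal_plus)
  also have "\<dots> \<le> ennreal c * (\<integral>\<^sup>+s. F s \<partial>N) + ennreal \<bar>LINT s|N. q s\<bar>"
    by (intro add_right_mono 1)
  finally show ?thesis .
qed

text \<open>
  The norm of a functional is an infimum over representing functions. Positivity of \<open>c\<close> and
  \<open>e\<close> covers the empty set, whose infimum is \<open>\<infinity>\<close>.
\<close>

lemma le_affine_Inf_ennreal:
  fixes S :: "ennreal set"
  assumes "0 < e" "0 < c" "e < \<infinity>" "c < \<infinity>" and le: "\<And>z. z \<in> S \<Longrightarrow> A \<le> e * (b + c * z)"
  shows "A \<le> e * (b + c * Inf S)"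
proof (cases "S = {}")
  case True
  then show ?thesis using assms(1,2) by (simp add: ennreal_mult_top zero_less_iff_neq_zero)
next
  case False
  have "((\<lambda>z. e * (b + c * z)) \<longlongrightarrow> e * (b + c * Inf S)) (at_right (Inf S))"
    using assms by (intro ennreal_tendsto_cmult tendsto_add tendsto_const tendsto_ident_at) auto
  then have "continuous (at_right (Inf S)) (\<lambda>z. e * (b + c * z))" by (simp add: continuous_within)
  then have "e * (b + c * Inf S) = (INF z\<in>S. e * (b + c * z))"
    using False by (intro continuous_at_Inf_mono monoI mult_left_mono add_left_mono) auto
  then show ?thesis using le by (auto intro: INF_greatest)
qed


section \<open>The residual of the interpolant and the error bound\<close>

text \<open>
  With \<open>\<theta> = (t\<^sub>j - s) / \<tau>\<^sub>j\<close> both interpolants are \<open>1 -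
  \<theta>\<close> times the new value plus \<open>\<theta>\<close> times the old one, whereas the scheme
  averages with weights \<open>1 / 2\<close>. The discrepancy \<open>\<theta> - 1 / 2\<close> is the offset of
  \<open>s\<close> from the midpoint, measured in units of \<open>\<tau>\<^sub>j\<close>.
\<close>

lemma crank_nicolson_residual:
  assumes \<Omega>: "open \<Omega>" and L: "elliptic \<Omega> L" and t: "mesh T M t" and j: "j \<in> {1..M}"
    and s: "s \<in> {t (j - 1)<..t j}" and f: "\<forall>s\<in>{0..T}. f s \<in> L2 \<Omega>"
    and cn: "crank_nicolson \<Omega> L f u0 M t U"
    and u: "u s \<in> H01 \<Omega>" "u' s \<in> H01 \<Omega>" and v: "v \<in> H01 \<Omega>"
    and eq: "parabolic_op \<Omega> L u u' s v = L2_inner \<Omega> (f s) v"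
  shows "parabolic_op \<Omega> L (\<lambda>s x. u s x - pl_interp t M U s x)
      (\<lambda>s x. u' s x - delta_t t U (mesh_index t M s) x) s v
    = L2_inner \<Omega> (\<lambda>x. f s x - lin_interp t f j s x) v
      + ((t (j - 1) + t j) / 2 - s) * delta_t t (psi \<Omega> L f t U) j v"
proof -
  define \<tau> where "\<tau> = step t j"
  define \<theta> where "\<theta> = (t j - s) / \<tau>"
  note mi = mesh_interval[OF t j]
  have \<tau>: "\<tau> > 0" using mi by (simp add: \<tau>_def)
  have st: "t j - s = \<theta> * \<tau>" using \<tau> by (simp add: \<theta>_def)
  have mid: "(t (j - 1) + t j) / 2 - s = (\<theta> - 1 / 2) * \<tau>"
  proof -
    have "(t (j - 1) + t j) / 2 - s = (t j - s) - \<tau> / 2" by (simp add: \<tau>_def step_def field_simps)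
    then show ?thesis unfolding st by (simp add: left_diff_distrib)
  qed
  have UH: "U j \<in> H01 \<Omega>" "U (j - 1) \<in> H01 \<Omega>"
    using cn j by (auto simp: crank_nicolson_def)
  have fL: "f (t j) \<in> L2 \<Omega>" "f (t (j - 1)) \<in> L2 \<Omega>" "f s \<in> L2 \<Omega>"
    using f mi s by auto
  note v2 = H01_L2[OF v]
  let ?F = "\<lambda>i. L2_inner \<Omega> (f (t i)) v" and ?L = "\<lambda>i. weak_op \<Omega> L (U i) v"
  have "L2_inner \<Omega> (\<lambda>x. (U j x - U (j - 1) x) / step t j) v + (?L j + ?L (j - 1)) / 2
      = L2_inner \<Omega> (\<lambda>x. (f (t j) x + f (t (j - 1)) x) / 2) v"
    using cn j v unfolding crank_nicolson_def by blast
  moreover have "L2_inner \<Omega> (\<lambda>x. (f (t j) x + f (t (j - 1)) x) / 2) v = (?F j + ?F (j - 1)) / 2"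
    using L2_inner_lincomb[OF fL(1,2) v2, of "1 / 2" "1 / 2"] by (simp add: add_divide_distrib)
  ultimately have \<delta>: "L2_inner \<Omega> (delta_t t U j) v = (?F j + ?F (j - 1)) / 2 - (?L j + ?L (j - 1)) / 2"
    unfolding delta_t_def by linarith
  have \<delta>L: "delta_t t U j \<in> L2 \<Omega>"
    using L2_lincomb_real[OF H01_L2[OF UH(1)] H01_L2[OF UH(2)], of "1 / \<tau>" "- 1 / \<tau>"]
    by (simp add: delta_t_def \<tau>_def diff_divide_distrib)
  have 1: "L2_inner \<Omega> (\<lambda>x. u' s x - delta_t t U j x) v = L2_inner \<Omega> (u' s) v - L2_inner \<Omega> (delta_t t U j) v"
    by (rule L2_inner_diff[OF H01_L2[OF u(2)] \<delta>L v2])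
  have \<theta>\<tau>: "\<theta> * \<tau> * (d / \<tau>) = \<theta> * d" for d using \<tau> by simp
  have pl: "pl_interp t M U s = (\<lambda>x. (1 - \<theta>) * U j x + \<theta> * U (j - 1) x)"
    by (rule ext) (simp only: pl_interp_eq[OF t j s] st delta_t_def \<tau>_def[symmetric] \<theta>\<tau>, simp add: algebra_simps)
  have li: "lin_interp t f j s = (\<lambda>x. (1 - \<theta>) * f (t j) x + \<theta> * f (t (j - 1)) x)"
    by (rule ext) (simp only: lin_interp_def st delta_t_def \<tau>_def[symmetric] \<theta>\<tau>, simp add: algebra_simps)
  have plH: "(\<lambda>x. (1 - \<theta>) * U j x + \<theta> * U (j - 1) x) \<in> H01 \<Omega>" by (rule H01_lincomb[OF \<Omega> UH])
  note H = H01_subset_H1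
  have 2: "weak_op \<Omega> L (\<lambda>x. u s x - pl_interp t M U s x) v = weak_op \<Omega> L (u s) v - ((1 - \<theta>) * ?L j + \<theta> * ?L (j - 1))"
    unfolding pl weak_op_diff[OF \<Omega> L H[OF u(1)] H[OF plH] H[OF v]]
      weak_op_lincomb[OF \<Omega> L H[OF UH(1)] H[OF UH(2)] H[OF v]] ..
  have 3: "L2_inner \<Omega> (\<lambda>x. f s x - lin_interp t f j s x) v = L2_inner \<Omega> (f s) v - ((1 - \<theta>) * ?F j + \<theta> * ?F (j - 1))"
    unfolding li L2_inner_diff[OF fL(3) L2_lincomb_real[OF fL(1,2)] v2] L2_inner_lincomb[OF fL(1,2) v2] ..
  have 4: "((t (j - 1) + t j) / 2 - s) * delta_t t (psi \<Omega> L f t U) j v = (\<theta> - 1 / 2) * ((?L j - ?F j) - (?L (j - 1) - ?F (j - 1)))"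
    using \<tau> by (simp only: mid delta_t_def psi_def \<tau>_def[symmetric]) simp
  have 5: "L2_inner \<Omega> (u' s) v + weak_op \<Omega> L (u s) v = L2_inner \<Omega> (f s) v"
    using eq by (simp add: parabolic_op_def)
  show ?thesis
    unfolding parabolic_op_def mesh_index_eq[OF t j s] 1 2 3 4 \<delta> using 5 by (simp add: algebra_simps add_divide_distrib)
qed

text \<open>
  The mesh points are lost in passing to open intervals, but they form a null set.
\<close>

lemma mesh_integral_split:
  fixes p :: "real \<Rightarrow> real"
  assumes t: "mesh T M t" and p: "integrable (lebesgue_on {0<..<T}) p"
  shows "\<And>j. j \<in> {1..M} \<Longrightarrow> integrable (lebesgue_on {t (j - 1)<..<t j}) p"
    and "(LINT s|lebesgue_on {0<..<T}. p s) = (\<Sum>j=1..M. LINT s|lebesgue_on {t (j - 1)<..<t j}. p s)"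
proof -
  have m: "{a<..<b} \<inter> space lebesgue \<in> sets lebesgue" for a b :: real by simp
  have sub: "{t (j - 1)<..<t j} \<subseteq> {0<..<T}" if "j \<in> {1..M}" for j
    using mesh_interval[OF t that] by auto
  have P: "integrable lebesgue (\<lambda>s. indicator {0<..<T} s *\<^sub>R p s)"
    using p by (simp only: integrable_restrict_space[OF m])
  have J: "integrable lebesgue (\<lambda>s. indicator {t (j - 1)<..<t j} s *\<^sub>R p s)" if "j \<in> {1..M}" for j
  proof -
    have "integrable lebesgue (\<lambda>s. indicator {t (j - 1)<..<t j} s *\<^sub>R (indicator {0<..<T} s *\<^sub>R p s))"
      by (rule integrable_mult_indicator[OF _ P]) simp
    moreover have "(\<lambda>s. indicator {t (j - 1)<..<t j} s *\<^sub>R (indicator {0<..<T} s *\<^sub>R p s))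
        = (\<lambda>s. indicator {t (j - 1)<..<t j} s *\<^sub>R p s)"
      using subsetD[OF sub[OF that]] by (auto simp: fun_eq_iff indicator_def)
    ultimately show ?thesis by simp
  qed
  show "integrable (lebesgue_on {t (j - 1)<..<t j}) p" if "j \<in> {1..M}" for j
    by (simp only: integrable_restrict_space[OF m] J[OF that])
  have "finite (t ` {..M})" by simp
  then have "t ` {..M} \<in> null_sets lebesgue"
    by (simp add: negligible_finite flip: negligible_iff_null_sets)
  then have "AE s in lebesgue. s \<notin> t ` {..M}" by (rule AE_not_in)
  then have ae: "AE s in lebesgue. indicator {0<..<T} s *\<^sub>R p s = (\<Sum>j=1..M. indicator {t (j - 1)<..<t j} s *\<^sub>R p s)"
  proof eventually_elim
    case (elim s)
    have ne: "s \<noteq> t j" if "j \<in> {1..M}" for j using elim that by auto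
    have i: "indicator {t (j - 1)<..<t j} s = (indicator {t (j - 1)<..t j} s :: real)" if "j \<in> {1..M}" for j
      using ne[OF that] by (auto simp: indicator_def)
    show ?case
    proof (cases "s \<in> {0<..<T}")
      case True
      then have "0 < s" "s \<le> T" by auto
      from mesh_intervals_cover[OF t this]
      obtain j where j: "j \<in> {1..M}" "s \<in> {t (j - 1)<..t j}" .
      have "(\<Sum>i=1..M. indicator {t (i - 1)<..<t i} s *\<^sub>R p s) = (\<Sum>i=1..M. if i = j then p s else 0)"
        by (intro sum.cong refl) (simp add: i indicator_mesh_interval[OF t _ j] del: One_nat_def)
      then show ?thesis using j(1) True by simp
    next
      case False
      have "(\<Sum>i=1..M. indicator {t (i - 1)<..<t i} s *\<^sub>R p s) = 0"
      proof (intro sum.neutral ballI)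
        fix i assume "i \<in> {1..M}"
        then have "s \<notin> {t (i - 1)<..<t i}" using sub False by blast
        then show "indicator {t (i - 1)<..<t i} s *\<^sub>R p s = 0" by simp
      qed
      then show ?thesis using False by simp
    qed
  qed
  have "(LINT s|lebesgue_on {0<..<T}. p s) = (LINT s|lebesgue. indicator {0<..<T} s *\<^sub>R p s)"
    by (rule integral_restrict_space[OF m])
  also have "\<dots> = (LINT s|lebesgue. (\<Sum>j=1..M. indicator {t (j - 1)<..<t j} s *\<^sub>R p s))"
    using P J ae by (intro integral_cong_AE borel_measurable_sum) (auto simp del: One_nat_def)
  also have "\<dots> = (\<Sum>j=1..M. LINT s|lebesgue. indicator {t (j - 1)<..<t j} s *\<^sub>R p s)"
    by (rule Bochner_Integration.integral_sum[OF J])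
  also have "\<dots> = (\<Sum>j=1..M. LINT s|lebesgue_on {t (j - 1)<..<t j}. p s)"
    by (simp only: integral_restrict_space[OF m])
  finally show "(LINT s|lebesgue_on {0<..<T}. p s) = (\<Sum>j=1..M. LINT s|lebesgue_on {t (j - 1)<..<t j}. p s)" .
qed

text \<open>
  On the \<open>j\<close>-th interval \<open>exp (- \<gamma> (T - s))\<close> is at most its value
  \<open>E\<close> at \<open>t\<^sub>j\<close>, which is pulled out of all integrals. The functional
  \<open>F\<close> stands for \<open>\<delta>\<^sub>t\<psi>\<^sup>j\<close> and \<open>g\<close> for any
  function that represents it.
\<close>

lemma green_interval_bound:
  assumes \<Omega>: "open \<Omega>" "x \<in> \<Omega>" and "T > 0" and G: "green_function \<Omega> L G dG"
    and B: "green_bounds \<Omega> T G dG \<kappa>\<^sub>0 \<kappa>\<^sub>1 \<kappa>\<^sub>1' \<gamma>"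
    and t: "mesh T M t" and j: "j \<in> {1..M}" and f: "\<forall>s\<in>{0..T}. f s \<in> L2 \<Omega>"
    and g: "represented_by \<Omega> F g"
    and p: "integrable (lebesgue_on {t (j - 1)<..<t j}) p"
    and eq: "AE s in lebesgue_on {t (j - 1)<..<t j}. p s = L2_inner \<Omega> (\<lambda>x. f s x - lin_interp t f j s x) (G x (T - s))
        + ((t (j - 1) + t j) / 2 - s) * F (G x (T - s))"
  shows "ennreal \<bar>LINT s|lebesgue_on {t (j - 1)<..<t j}. p s\<bar> \<le> ennreal (exp (- \<gamma> * (T - t j))) *
      (eta_f \<Omega> \<kappa>\<^sub>0 t f j + ennreal (Psi1 \<kappa>\<^sub>0 \<kappa>\<^sub>1 \<kappa>\<^sub>1' T t j / 2) * Linf_norm \<Omega> g)"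
proof (cases "Linf_norm \<Omega> g < \<infinity>")
  \<comment> \<open>The right-hand side is infinite, since the factor of the norm is positive.\<close>
  case False
  have "Psi1 \<kappa>\<^sub>0 \<kappa>\<^sub>1 \<kappa>\<^sub>1' T t j > 0"
    using green_constants_pos[OF \<Omega> \<open>T > 0\<close> G B] B by (intro Psi1_pos[OF t j]) (auto simp: green_bounds_def)
  moreover have "Linf_norm \<Omega> g = top" using False top.not_eq_extremum by fastforce
  ultimately show ?thesis by (simp add: ennreal_mult_top)
next
  case True
  define a b where "a = t (j - 1)" and "b = t j"
  have ab: "0 \<le> a" "a < b" "b \<le> T" using mesh_interval[OF t j] by (auto simp: a_def b_def)
  define E where "E = exp (- \<gamma> * (T - b))"
  define N where "N = enn2real (Linf_norm \<Omega> g)"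
  have N: "Linf_norm \<Omega> g = ennreal N" "N \<ge> 0" using True by (auto simp: N_def)
  have E: "E > 0" by (simp add: E_def)
  have k: "\<kappa>\<^sub>0 > 0" "\<kappa>\<^sub>1 \<ge> 0" "\<kappa>\<^sub>1' \<ge> 0" "\<gamma> \<ge> 0"
    using green_constants_pos[OF \<Omega> \<open>T > 0\<close> G B] B by (auto simp: green_bounds_def)
  have gm: "g \<in> borel_measurable (lebesgue_on \<Omega>)" using g by (simp add: represented_by_def)
  have G1: "G x s \<in> H01 \<Omega>" "integrable (lebesgue_on \<Omega>) (G x s)" "has_L1_time_deriv \<Omega> (G x) (dG x s) s" if "s > 0" for s
    using G \<Omega>(2) that by (auto simp: green_function_def)
  have exp_le: "exp (- \<gamma> * (T - s)) \<le> E" if "s \<le> b" for s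
    using that k(4) by (simp add: E_def mult_left_mono)
  have L1G: "L1_norm \<Omega> (G x (T - s)) \<le> ennreal (\<kappa>\<^sub>0 * E)" if "s \<in> {a..<b}" for s
  proof -
    have "T - s \<in> {0<..T}" using that ab by auto
    then have "L1_norm \<Omega> (G x (T - s)) \<le> ennreal (\<kappa>\<^sub>0 * exp (- \<gamma> * (T - s)))"
      using B \<Omega>(2) unfolding green_bounds_def by blast
    also have "\<dots> \<le> ennreal (\<kappa>\<^sub>0 * E)"
      using exp_le[of s] that k(1) by (intro ennreal_leI mult_left_mono) auto
    finally show ?thesis .
  qed
  have L1dG: "L1_norm \<Omega> (dG x (T - s)) \<le> ennreal ((\<kappa>\<^sub>1 / (T - s) + \<kappa>\<^sub>1') * E)" if "s \<in> {a..<b}" for s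
  proof -
    have Ts: "T - s \<in> {0<..T}" using that ab by auto
    then have "L1_norm \<Omega> (dG x (T - s)) \<le> ennreal ((\<kappa>\<^sub>1 / (T - s) + \<kappa>\<^sub>1') * exp (- \<gamma> * (T - s)))"
      using B \<Omega>(2) unfolding green_bounds_def by blast
    also have "\<dots> \<le> ennreal ((\<kappa>\<^sub>1 / (T - s) + \<kappa>\<^sub>1') * E)"
      using exp_le[of s] that k Ts by (intro ennreal_leI mult_left_mono) auto
    finally show ?thesis .
  qed
  define D where "D s = L2_inner \<Omega> g (G x (T - s))" for s
  define D' where "D' s = - L2_inner \<Omega> g (dG x (T - s))" for s
  have deriv: "(D has_real_derivative D' s) (at s)" if "s \<in> {a..<b}" for s
  proof -
    have Ts: "T - s > 0" using that ab by auto
    have "((\<lambda>r. L2_inner \<Omega> g (G x r)) has_real_derivative L2_inner \<Omega> g (dG x (T - s))) (at (T - s))"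
      by (rule has_real_derivative_L2_inner[OF gm True G1(2) Ts G1(3)[OF Ts]])
    moreover have "((\<lambda>s. T - s) has_real_derivative - 1) (at s)"
      by (auto intro!: derivative_eq_intros)
    ultimately have "((\<lambda>s. L2_inner \<Omega> g (G x (T - s))) has_real_derivative L2_inner \<Omega> g (dG x (T - s)) * - 1) (at s)"
      by (rule DERIV_chain2)
    then show ?thesis by (simp add: D_def[abs_def] D'_def)
  qed
  have Db: "\<bar>D s\<bar> \<le> N * \<kappa>\<^sub>0 * E" if "s \<in> {a..<b}" for s
  proof -
    have "ennreal \<bar>D s\<bar> \<le> Linf_norm \<Omega> g * L1_norm \<Omega> (G x (T - s))"
      unfolding D_def using G1(2)[of "T - s"] that ab by (intro abs_L2_inner_le_Linf_L1 gm) auto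
    also have "\<dots> \<le> ennreal N * ennreal (\<kappa>\<^sub>0 * E)"
      unfolding N(1) by (rule mult_left_mono[OF L1G[OF that]]) simp
    also have "\<dots> = ennreal (N * \<kappa>\<^sub>0 * E)" using N(2) k E by (simp add: ennreal_mult[symmetric] mult.assoc)
    finally show ?thesis using N(2) k E by (subst (asm) ennreal_le_iff) auto
  qed
  have Db': "\<bar>D' s\<bar> \<le> N * E * (\<kappa>\<^sub>1 / (T - s) + \<kappa>\<^sub>1')" if "s \<in> {a<..<b}" for s
  proof -
    have s: "s \<in> {a..<b}" "T - s > 0" using that ab by auto
    have nn: "0 \<le> \<kappa>\<^sub>1 / (T - s) + \<kappa>\<^sub>1'" using s(2) k by auto
    have "ennreal \<bar>L2_inner \<Omega> g (dG x (T - s))\<bar> \<le> Linf_norm \<Omega> g * L1_norm \<Omega> (dG x (T - s))"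
      using G1(3)[OF s(2)] by (intro abs_L2_inner_le_Linf_L1 gm) (auto simp: has_L1_time_deriv_def)
    also have "\<dots> \<le> ennreal N * ennreal ((\<kappa>\<^sub>1 / (T - s) + \<kappa>\<^sub>1') * E)"
      unfolding N(1) by (rule mult_left_mono[OF L1dG[OF s(1)]]) simp
    also have "\<dots> = ennreal (N * E * (\<kappa>\<^sub>1 / (T - s) + \<kappa>\<^sub>1'))"
      using N(2) nn E by (simp add: ennreal_mult[symmetric] mult.assoc mult.commute)
    finally have "\<bar>L2_inner \<Omega> g (dG x (T - s))\<bar> \<le> N * E * (\<kappa>\<^sub>1 / (T - s) + \<kappa>\<^sub>1')"
      using N(2) nn E by (subst (asm) ennreal_le_iff) auto
    then show ?thesis by (simp add: D'_def)
  qed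
  let ?q = "\<lambda>s. ((a + b) / 2 - s) * D s"
  have Dc: "continuous_on {a<..<b} D"
    using DERIV_isCont[OF deriv] by (intro continuous_at_imp_continuous_on) auto
  have q: "integrable (lebesgue_on {a<..<b}) ?q" "(LINT s|lebesgue_on {a<..<b}. ?q s) = integral {a..b} ?q"
  proof -
    have c: "continuous_on {a<..<b} ?q" by (intro continuous_intros Dc)
    have "\<bar>?q s\<bar> \<le> (b - a) * (N * \<kappa>\<^sub>0 * E)" if s: "s \<in> {a<..<b}" for s
    proof -
      have "\<bar>(a + b) / 2 - s\<bar> \<le> b - a" using s by (auto simp: field_simps abs_if)
      then show ?thesis using Db[of s] s by (auto simp: abs_mult intro!: mult_mono)
    qed
    from bounded_continuous_Ioo_integrable[OF c this]
    show "integrable (lebesgue_on {a<..<b}) ?q" "(LINT s|lebesgue_on {a<..<b}. ?q s) = integral {a..b} ?q" by auto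
  qed
  have "\<bar>integral {a..b} ?q\<bar> \<le> N * E / 2 * Phi1 \<kappa>\<^sub>1 \<kappa>\<^sub>1' T t j"
    using by_parts_bound[OF ab(2,3) deriv Db Db'] by (simp add: Phi1_def step_def a_def b_def)
  moreover have "\<bar>integral {a..b} ?q\<bar> \<le> N * E / 2 * Phi1_star \<kappa>\<^sub>0 t j"
    using midpoint_weight_bound[OF ab(2) Dc, of "N * \<kappa>\<^sub>0 * E"] Db
    by (simp add: Phi1_star_def a_def b_def mult.assoc mult.left_commute)
  ultimately have qb: "\<bar>integral {a..b} ?q\<bar> \<le> N * E / 2 * Psi1 \<kappa>\<^sub>0 \<kappa>\<^sub>1 \<kappa>\<^sub>1' T t j"
    by (simp add: Psi1_def min_def)
  have in_ab: "AE s in lebesgue_on {a<..<b}. s \<in> {a<..<b}" by (rule AE_I2) simp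
  have eq': "AE s in lebesgue_on {a<..<b}. p s = L2_inner \<Omega> (\<lambda>x. f s x - lin_interp t f j s x) (G x (T - s)) + ?q s"
    using eq in_ab unfolding a_def[symmetric] b_def[symmetric]
  proof eventually_elim
    case (elim s)
    then have "T - s > 0" using ab by auto
    then have "F (G x (T - s)) = D s" unfolding D_def
      using g G1(1,2) by (auto simp: represented_by_def)
    with elim show ?case by simp
  qed
  have h: "AE s in lebesgue_on {a<..<b}. ennreal \<bar>L2_inner \<Omega> (\<lambda>x. f s x - lin_interp t f j s x) (G x (T - s))\<bar>
      \<le> ennreal (\<kappa>\<^sub>0 * E) * Linf_norm \<Omega> (\<lambda>x. f s x - lin_interp t f j s x)"
    using in_ab
  proof eventually_elim
    case (elim s)
    have fL: "f s \<in> L2 \<Omega>" "f (t j) \<in> L2 \<Omega>" "f (t (j - 1)) \<in> L2 \<Omega>"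
      using f elim ab by (auto simp: a_def b_def)
    have [measurable]: "f s \<in> borel_measurable (lebesgue_on \<Omega>)" "f (t j) \<in> borel_measurable (lebesgue_on \<Omega>)"
      "f (t (j - 1)) \<in> borel_measurable (lebesgue_on \<Omega>)"
      using fL by (auto simp: L2_def)
    have "(\<lambda>x. f s x - lin_interp t f j s x) \<in> borel_measurable (lebesgue_on \<Omega>)"
      unfolding lin_interp_def delta_t_def by measurable
    then have "ennreal \<bar>L2_inner \<Omega> (\<lambda>x. f s x - lin_interp t f j s x) (G x (T - s))\<bar>
      \<le> Linf_norm \<Omega> (\<lambda>x. f s x - lin_interp t f j s x) * L1_norm \<Omega> (G x (T - s))"
      using G1(2)[of "T - s"] elim ab by (intro abs_L2_inner_le_Linf_L1) auto
    also have "\<dots> \<le> Linf_norm \<Omega> (\<lambda>x. f s x - lin_interp t f j s x) * ennreal (\<kappa>\<^sub>0 * E)"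
      using elim by (intro mult_left_mono L1G) auto
    finally show ?case by (simp add: mult.commute)
  qed
  have p': "integrable (lebesgue_on {a<..<b}) p" using p by (simp add: a_def b_def)
  let ?I = "\<integral>\<^sup>+s. Linf_norm \<Omega> (\<lambda>x. f s x - lin_interp t f j s x) \<partial>lebesgue_on {a<..<b}"
  have "ennreal \<bar>LINT s|lebesgue_on {a<..<b}. p s\<bar> \<le> ennreal (\<kappa>\<^sub>0 * E) * ?I + ennreal \<bar>LINT s|lebesgue_on {a<..<b}. ?q s\<bar>"
    by (rule interval_contribution_bound[OF p' q(1) _ eq' h]) (use k E in simp)
  also have "\<dots> \<le> ennreal (\<kappa>\<^sub>0 * E) * ?I + ennreal (N * E / 2 * Psi1 \<kappa>\<^sub>0 \<kappa>\<^sub>1 \<kappa>\<^sub>1' T t j)"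
    unfolding q(2) by (intro add_left_mono ennreal_leI qb)
  also have "\<dots> = ennreal E * (ennreal \<kappa>\<^sub>0 * ?I + ennreal (Psi1 \<kappa>\<^sub>0 \<kappa>\<^sub>1 \<kappa>\<^sub>1' T t j / 2) * ennreal N)"
  proof -
    have "ennreal (N * E / 2 * Psi1 \<kappa>\<^sub>0 \<kappa>\<^sub>1 \<kappa>\<^sub>1' T t j) = ennreal E * (ennreal (Psi1 \<kappa>\<^sub>0 \<kappa>\<^sub>1 \<kappa>\<^sub>1' T t j / 2) * ennreal N)"
    proof -
      have "N * E / 2 * Psi1 \<kappa>\<^sub>0 \<kappa>\<^sub>1 \<kappa>\<^sub>1' T t j = E * (N * (Psi1 \<kappa>\<^sub>0 \<kappa>\<^sub>1 \<kappa>\<^sub>1' T t j / 2))" by simp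
      also have "ennreal \<dots> = ennreal E * (ennreal N * ennreal (Psi1 \<kappa>\<^sub>0 \<kappa>\<^sub>1 \<kappa>\<^sub>1' T t j / 2))"
        using E N(2) by (simp only: ennreal_mult' less_imp_le)
      finally show ?thesis by (simp add: mult.commute)
    qed
    moreover have "ennreal (\<kappa>\<^sub>0 * E) = ennreal E * ennreal \<kappa>\<^sub>0"
      using E k(1) by (simp add: ennreal_mult mult.commute)
    ultimately show ?thesis by (simp add: distrib_left mult.assoc)
  qed
  finally show ?thesis unfolding eta_f_def N(1) E_def a_def b_def .
qed

theorem theorem7:
  fixes \<Omega> :: "(real^'n) set"
    and L :: "'n operator_coeffs"
    and T \<kappa>\<^sub>0 \<kappa>\<^sub>1 \<kappa>\<^sub>1' \<gamma> :: real
    and f u :: "real \<Rightarrow> real^'n \<Rightarrow> real"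
    and u0 :: "real^'n \<Rightarrow> real"
    and G dG :: "real^'n \<Rightarrow> real \<Rightarrow> real^'n \<Rightarrow> real"
    and M :: nat and t :: "nat \<Rightarrow> real" and U :: "nat \<Rightarrow> real^'n \<Rightarrow> real"
  assumes "lipschitz_domain \<Omega>" and "T > 0" and "elliptic \<Omega> L"
    and "\<forall>s\<in>{0..T}. f s \<in> L2 \<Omega>"
    and "green_function \<Omega> L G dG"
    and "green_representation \<Omega> T L G"
    and "green_bounds \<Omega> T G dG \<kappa>\<^sub>0 \<kappa>\<^sub>1 \<kappa>\<^sub>1' \<gamma>"
    and "parabolic_solution \<Omega> T L f u0 u"
    and "mesh T M t"
    and "crank_nicolson \<Omega> L f u0 M t U"
  shows "Linf_norm \<Omega> (\<lambda>x. u T x - U M x)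
    \<le> (\<Sum>j=1..M. ennreal (exp (- \<gamma> * (T - t j))) *
          (eta_f \<Omega> \<kappa>\<^sub>0 t f j + eta_psi \<Omega> L \<kappa>\<^sub>0 \<kappa>\<^sub>1 \<kappa>\<^sub>1' T f t U j))"
proof -
  have \<Omega>: "open \<Omega>" using assms(1) by (simp add: lipschitz_domain_def)
  have ms: "\<Omega> \<in> sets lebesgue" using \<Omega> by (simp add: borel_open)
  note T = assms(2) and L = assms(3) and f = assms(4) and G = assms(5) and B = assms(7) and t = assms(9) and cn = assms(10)
  obtain u' where W: "W11_H01 \<Omega> T u u'"
    and pde: "AE s in lebesgue_on {0..T}. \<forall>v\<in>H01 \<Omega>. parabolic_op \<Omega> L u u' s v = L2_inner \<Omega> (f s) v"
    and u0: "AE x in lebesgue_on \<Omega>. u 0 x = u0 x"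
    using assms(8) by (auto simp: parabolic_solution_def)
  have U: "\<And>j. j \<le> M \<Longrightarrow> U j \<in> H01 \<Omega>" and U0: "AE x in lebesgue_on \<Omega>. U 0 x = u0 x"
    using cn by (auto simp: crank_nicolson_def)
  define w where "w = (\<lambda>s x. u s x - pl_interp t M U s x)"
  define w' where "w' = (\<lambda>s x. u' s x - delta_t t U (mesh_index t M s) x)"
  have Ww: "W11_H01 \<Omega> T w w'" unfolding w_def w'_def by (rule W11_H01_minus_pl_interp[OF \<Omega> t U W])
  have uH: "u s \<in> H01 \<Omega>" if "s \<in> {0..T}" for s using W that by (simp add: W11_H01_def)
  have "has_H01_integral \<Omega> {0..T} u' (\<lambda>x. u T x - u 0 x)" using W T by (simp add: W11_H01_def)
  then have u'H: "AE s in lebesgue_on {0..T}. u' s \<in> H01 \<Omega>" unfolding has_H01_integral_def by blast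
  \<comment> \<open>The error and the approximation start from the same initial value, so the term with \<open>w 0\<close> drops out.\<close>
  have w0: "AE x in lebesgue_on \<Omega>. w 0 x = 0"
    using u0 U0 by eventually_elim (simp add: w_def pl_interp_0[OF t])
  have rep: "AE x in lebesgue_on \<Omega>.
        integrable (lebesgue_on {0<..<T}) (\<lambda>s. parabolic_op \<Omega> L w w' s (G x (T - s))) \<and>
        w T x = L2_inner \<Omega> (G x T) (w 0)
          + (LINT s|lebesgue_on {0<..<T}. parabolic_op \<Omega> L w w' s (G x (T - s)))"
    using assms(6) Ww T unfolding green_representation_def by auto
  let ?R = "\<Sum>j=1..M. ennreal (exp (- \<gamma> * (T - t j))) * (eta_f \<Omega> \<kappa>\<^sub>0 t f j + eta_psi \<Omega> L \<kappa>\<^sub>0 \<kappa>\<^sub>1 \<kappa>\<^sub>1' T f t U j)"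
  have "AE x in lebesgue_on \<Omega>. x \<in> \<Omega>" by (rule AE_I2) simp
  with rep have "AE x in lebesgue_on \<Omega>. ennreal \<bar>u T x - U M x\<bar> \<le> ?R"
  proof eventually_elim
    case (elim x)
    then have x: "x \<in> \<Omega>" by simp
    define p where "p s = parabolic_op \<Omega> L w w' s (G x (T - s))" for s
    have pi: "integrable (lebesgue_on {0<..<T}) p" using elim by (simp add: p_def[abs_def])
    have GH: "G x s \<in> H01 \<Omega>" if "s > 0" for s using G x that by (auto simp: green_function_def)
    have "L2_inner \<Omega> (G x T) (w 0) = 0"
      unfolding L2_inner_def using w0 by (intro integral_eq_zero_AE) (auto elim: eventually_mono)
    then have "u T x - U M x = (LINT s|lebesgue_on {0<..<T}. p s)"
      using elim pl_interp_T[OF t T, of U] by (simp add: p_def w_def)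
    then have "ennreal \<bar>u T x - U M x\<bar> \<le> ennreal (\<Sum>j=1..M. \<bar>LINT s|lebesgue_on {t (j - 1)<..<t j}. p s\<bar>)"
      unfolding mesh_integral_split(2)[OF t pi] by (intro ennreal_leI) (simp add: sum_abs)
    also have "\<dots> = (\<Sum>j=1..M. ennreal \<bar>LINT s|lebesgue_on {t (j - 1)<..<t j}. p s\<bar>)"
      by (simp add: sum_ennreal)
    also have "\<dots> \<le> ?R"
    proof (rule sum_mono)
      fix j assume j: "j \<in> {1..M}"
      let ?I = "{t (j - 1)<..<t j}"
      note mi = mesh_interval[OF t j]
      have sub: "AE s in lebesgue_on ?I. P s" if "AE s in lebesgue_on {0..T}. P s" for P
      proof -
        have "AE s in lebesgue. s \<in> {0..T} \<longrightarrow> P s" using that by (simp add: AE_restrict_space_iff)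
        then have "AE s in lebesgue. s \<in> ?I \<longrightarrow> P s"
          by (rule eventually_mono) (use mi in auto)
        then show ?thesis by (simp add: AE_restrict_space_iff)
      qed
      have in_I: "AE s in lebesgue_on ?I. s \<in> ?I" by (rule AE_I2) simp
      have eq: "AE s in lebesgue_on ?I. p s = L2_inner \<Omega> (\<lambda>x. f s x - lin_interp t f j s x) (G x (T - s))
        + ((t (j - 1) + t j) / 2 - s) * delta_t t (psi \<Omega> L f t U) j (G x (T - s))"
        using sub[OF pde] sub[OF u'H] in_I
      proof eventually_elim
        case (elim s)
        have s: "s \<in> {t (j - 1)<..t j}" "s \<in> {0..T}" "T - s > 0" using elim(3) mi by auto
        have e: "parabolic_op \<Omega> L u u' s (G x (T - s)) = L2_inner \<Omega> (f s) (G x (T - s))"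
          using elim(1) GH[OF s(3)] by blast
        show ?case unfolding p_def w_def w'_def
          by (rule crank_nicolson_residual[OF \<Omega> L t j s(1) f cn uH[OF s(2)] elim(2) GH[OF s(3)] e])
      qed
      show "ennreal \<bar>LINT s|lebesgue_on ?I. p s\<bar> \<le> ennreal (exp (- \<gamma> * (T - t j))) *
         (eta_f \<Omega> \<kappa>\<^sub>0 t f j + eta_psi \<Omega> L \<kappa>\<^sub>0 \<kappa>\<^sub>1 \<kappa>\<^sub>1' T f t U j)"
        unfolding eta_psi_def Linf_norm_functional_def
      proof (rule le_affine_Inf_ennreal)
        have "Psi1 \<kappa>\<^sub>0 \<kappa>\<^sub>1 \<kappa>\<^sub>1' T t j > 0"
          using green_constants_pos[OF \<Omega> x T G B] B by (intro Psi1_pos[OF t j]) (auto simp: green_bounds_def)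
        then show "0 < ennreal (Psi1 \<kappa>\<^sub>0 \<kappa>\<^sub>1 \<kappa>\<^sub>1' T t j / 2)" by simp
        fix z assume "z \<in> {Linf_norm \<Omega> g |g. represented_by \<Omega> (delta_t t (psi \<Omega> L f t U) j) g}"
        then obtain g where g: "z = Linf_norm \<Omega> g" "represented_by \<Omega> (delta_t t (psi \<Omega> L f t U) j) g" by blast
        show "ennreal \<bar>LINT s|lebesgue_on ?I. p s\<bar> \<le> ennreal (exp (- \<gamma> * (T - t j))) *
            (eta_f \<Omega> \<kappa>\<^sub>0 t f j + ennreal (Psi1 \<kappa>\<^sub>0 \<kappa>\<^sub>1 \<kappa>\<^sub>1' T t j / 2) * z)"
          unfolding g(1)
          by (rule green_interval_bound[OF \<Omega> x T G B t j f g(2) mesh_integral_split(1)[OF t pi j] eq])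
      qed auto
    qed
    finally show ?case .
  qed
  moreover have "(\<lambda>x. u T x - U M x) \<in> borel_measurable (lebesgue_on \<Omega>)"
    using L2_diff[OF H01_L2[OF uH] H01_L2[OF U], of T M] T by (simp add: L2_def)
  ultimately show ?thesis
    unfolding Linf_norm_def by (intro esssup_I) auto
qed

end
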